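(* Let $\mathbb{M}$ be a monster model of a complete $C$-minimal expansion of ACVF whose language contains a constant symbol $t$ with $v(t)>0$, and suppose $\mathbb{M}$ is definably complete. Let $U\subseteq\mathbb{M}^n$ be a definable open set and $f:U\to\mathbb{M}^n$ a definable function that is strictly differentiable at every point of $U$. Let $a\in U$ be a point at which the strict derivative $Df(a)$ (an $n\times n$ matrix) is invertible. Then there are open neighborhoods $U_0\ni a$ and $V_0\ni f(a)$ such that $f$ restricts to a homeomorphism $U_0\to V_0$ and the inverse map $f^{-1}:V_0\to U_0$ is strictly differentiable.
   Context: ACVF is the theory of algebraically closed non-trivially valued fields; $C$-minimal means every definable subset of the home sort is a finite boolean combination of balls and points. "Definable" means with parameters; $\mathbb{M}^n$ carries the product valuation topology, and $v(c)=\min_i v(c_i)$ for a tuple $c$. $\mathbb{M}$ is definably complete if every definable chain of balls whose radii approach $+\infty$ has non-empty intersection. $f$ is strictly differentiable at $a$ with strict derivative $L=Df(a)$ if $L$ is linear and $v(f(x)-f(y)-L(x-y))-v(x-y)\to+\infty$ as $(x,y)\to(a,a)$ with $x\neq y$. *)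

theory Defs
  imports
    "HOL-Analysis.Analysis"
    "HOL-Algebra.Algebraic_Closure"
    "HOL-Library.Extended"
begin

unbundle cardinal_syntax

section \<open>First-order logic over expansions of the language of valued fields\<close>

text \<open>
  One-sorted languages containing \<open>0, 1, +, -, \<cdot>\<close> and the divisibility relation \<open>x | y\<close>, read
  \<open>v x \<le> v y\<close>; the symbols of the expansion are \<open>FExt f\<close> and \<open>RExt r\<close>. The sort quantified over is
  the home sort. A language is given by the arities of the additional symbols.
\<close>

datatype 'f fsym = FZero | FOne | FAdd | FNeg | FMul | FExt 'f
datatype 'r rsym = RDiv | RExt 'r

record ('f, 'r) lang =
  ext_farity :: "'f \<Rightarrow> nat"
  ext_rarity :: "'r \<Rightarrow> nat"

fun farity :: "('f, 'r) lang \<Rightarrow> 'f fsym \<Rightarrow> nat" where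
  "farity L FZero = 0"
| "farity L FOne = 0"
| "farity L FAdd = 2"
| "farity L FNeg = 1"
| "farity L FMul = 2"
| "farity L (FExt f) = ext_farity L f"

fun rarity :: "('f, 'r) lang \<Rightarrow> 'r rsym \<Rightarrow> nat" where
  "rarity L RDiv = 2"
| "rarity L (RExt r) = ext_rarity L r"

text \<open>Variables are de Bruijn indices.\<close>

datatype 'f tm = TVar nat | TApp "'f fsym" "'f tm list"

datatype ('f, 'r) fm =
    FmEq "'f tm" "'f tm"
  | FmRel "'r rsym" "'f tm list"
  | FmNot "('f, 'r) fm"
  | FmAnd "('f, 'r) fm" "('f, 'r) fm"
  | FmEx "('f, 'r) fm"

fun wf_tm :: "('f, 'r) lang \<Rightarrow> 'f tm \<Rightarrow> bool" where
  "wf_tm L (TVar i) \<longleftrightarrow> True"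
| "wf_tm L (TApp f ts) \<longleftrightarrow> length ts = farity L f \<and> (\<forall>s \<in> set ts. wf_tm L s)"

fun wf_fm :: "('f, 'r) lang \<Rightarrow> ('f, 'r) fm \<Rightarrow> bool" where
  "wf_fm L (FmEq s u) \<longleftrightarrow> wf_tm L s \<and> wf_tm L u"
| "wf_fm L (FmRel r ts) \<longleftrightarrow> length ts = rarity L r \<and> (\<forall>s \<in> set ts. wf_tm L s)"
| "wf_fm L (FmNot \<phi>) \<longleftrightarrow> wf_fm L \<phi>"
| "wf_fm L (FmAnd \<phi> \<psi>) \<longleftrightarrow> wf_fm L \<phi> \<and> wf_fm L \<psi>"
| "wf_fm L (FmEx \<phi>) \<longleftrightarrow> wf_fm L \<phi>"

fun fv_tm :: "'f tm \<Rightarrow> nat set" where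
  "fv_tm (TVar i) = {i}"
| "fv_tm (TApp f ts) = (\<Union>s \<in> set ts. fv_tm s)"

fun fv :: "('f, 'r) fm \<Rightarrow> nat set" where
  "fv (FmEq s u) = fv_tm s \<union> fv_tm u"
| "fv (FmRel r ts) = (\<Union>s \<in> set ts. fv_tm s)"
| "fv (FmNot \<phi>) = fv \<phi>"
| "fv (FmAnd \<phi> \<psi>) = fv \<phi> \<union> fv \<psi>"
| "fv (FmEx \<phi>) = {i. Suc i \<in> fv \<phi>}"

record ('a, 'f, 'r) struct =
  Univ :: "'a set"
  Fun :: "'f fsym \<Rightarrow> 'a list \<Rightarrow> 'a"
  Rel :: "'r rsym \<Rightarrow> 'a list \<Rightarrow> bool"

text \<open>Interpretations of symbols on lists of the wrong length or outside the universe are junk.\<close>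

definition is_structure :: "('f, 'r) lang \<Rightarrow> ('a, 'f, 'r) struct \<Rightarrow> bool" where
  "is_structure L N \<longleftrightarrow> Univ N \<noteq> {} \<and>
     (\<forall>f xs. length xs = farity L f \<and> set xs \<subseteq> Univ N \<longrightarrow> Fun N f xs \<in> Univ N)"

fun val_tm :: "('a, 'f, 'r) struct \<Rightarrow> (nat \<Rightarrow> 'a) \<Rightarrow> 'f tm \<Rightarrow> 'a" where
  "val_tm N e (TVar i) = e i"
| "val_tm N e (TApp f ts) = Fun N f (map (val_tm N e) ts)"

fun sat :: "('a, 'f, 'r) struct \<Rightarrow> (nat \<Rightarrow> 'a) \<Rightarrow> ('f, 'r) fm \<Rightarrow> bool" where
  "sat N e (FmEq s u) \<longleftrightarrow> val_tm N e s = val_tm N e u"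
| "sat N e (FmRel r ts) \<longleftrightarrow> Rel N r (map (val_tm N e) ts)"
| "sat N e (FmNot \<phi>) \<longleftrightarrow> \<not> sat N e \<phi>"
| "sat N e (FmAnd \<phi> \<psi>) \<longleftrightarrow> sat N e \<phi> \<and> sat N e \<psi>"
| "sat N e (FmEx \<phi>) \<longleftrightarrow> (\<exists>x \<in> Univ N. sat N (case_nat x e) \<phi>)"

definition is_sentence :: "('f, 'r) lang \<Rightarrow> ('f, 'r) fm \<Rightarrow> bool" where
  "is_sentence L \<sigma> \<longleftrightarrow> wf_fm L \<sigma> \<and> fv \<sigma> = {}"

definition is_theory :: "('f, 'r) lang \<Rightarrow> ('f, 'r) fm set \<Rightarrow> bool" where
  "is_theory L T \<longleftrightarrow> (\<forall>\<sigma> \<in> T. is_sentence L \<sigma>)"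

definition is_model :: "('f, 'r) lang \<Rightarrow> ('a, 'f, 'r) struct \<Rightarrow> ('f, 'r) fm set \<Rightarrow> bool" where
  "is_model L N T \<longleftrightarrow> is_structure L N \<and>
     (\<forall>\<sigma> \<in> T. \<forall>e. range e \<subseteq> Univ N \<longrightarrow> sat N e \<sigma>)"

text \<open>
  HOL cannot quantify over types inside a formula, so quantification over all models of a theory
  ranges over the structures whose universe is a subset of the type \<open>'a\<close>. By Loewenheim--Skolem
  this is no restriction as soon as \<open>'a\<close> has at least as many elements as there are formulas,
  which is the case when \<open>'a\<close> carries a monster model as defined below.
\<close>

definition entails :: "'a itself \<Rightarrow> ('f, 'r) lang \<Rightarrow> ('f, 'r) fm set \<Rightarrow> ('f, 'r) fm \<Rightarrow> bool" where
  "entails _ L T \<sigma> \<longleftrightarrow> (\<forall>N :: ('a, 'f, 'r) struct. is_model L N T \<longrightarrow> is_model L N {\<sigma>})"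

definition complete_theory :: "'a itself \<Rightarrow> ('f, 'r) lang \<Rightarrow> ('f, 'r) fm set \<Rightarrow> bool" where
  "complete_theory A L T \<longleftrightarrow> is_theory L T \<and>
     (\<exists>N :: ('a, 'f, 'r) struct. is_model L N T) \<and>
     (\<forall>\<sigma>. is_sentence L \<sigma> \<longrightarrow> entails A L T \<sigma> \<or> entails A L T (FmNot \<sigma>))"

text \<open>\<open>definable L N k S\<close>: \<open>S \<subseteq> N\<^sup>k\<close> (tuples are lists) is definable in \<open>N\<close> with parameters,
  which are given by the values \<open>e i\<close> for \<open>i \<ge> k\<close>.\<close>

definition definable ::
  "('f, 'r) lang \<Rightarrow> ('a, 'f, 'r) struct \<Rightarrow> nat \<Rightarrow> 'a list set \<Rightarrow> bool" where
  "definable L N k S \<longleftrightarrow> (\<exists>\<phi> e. wf_fm L \<phi> \<and> range e \<subseteq> Univ N \<and>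
     S = {xs. length xs = k \<and> set xs \<subseteq> Univ N \<and>
              sat N (\<lambda>i. if i < k then xs ! i else e i) \<phi>})"


section \<open>Monster models\<close>

text \<open>A type in one variable over \<open>A\<close> is given as a set of pairs of a formula and an assignment
  mapping all free variables other than 0 into \<open>A\<close>.\<close>

definition saturated :: "('f, 'r) lang \<Rightarrow> 'k rel \<Rightarrow> ('a, 'f, 'r) struct \<Rightarrow> bool" where
  "saturated L \<kappa> N \<longleftrightarrow>
     (\<forall>A \<subseteq> Univ N. |A| <o \<kappa> \<longrightarrow>
       (\<forall>p :: (('f, 'r) fm \<times> (nat \<Rightarrow> 'a)) set.
          (\<forall>(\<phi>, e) \<in> p. wf_fm L \<phi> \<and> e ` (fv \<phi> - {0}) \<subseteq> A) \<and>
          (\<forall>q \<subseteq> p. finite q \<longrightarrow> (\<exists>x \<in> Univ N. \<forall>(\<phi>, e) \<in> q. sat N (e(0 := x)) \<phi>))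
          \<longrightarrow> (\<exists>x \<in> Univ N. \<forall>(\<phi>, e) \<in> p. sat N (e(0 := x)) \<phi>)))"

definition elementary_map ::
  "('f, 'r) lang \<Rightarrow> ('a, 'f, 'r) struct \<Rightarrow> 'a set \<Rightarrow> ('a \<Rightarrow> 'a) \<Rightarrow> bool" where
  "elementary_map L N A h \<longleftrightarrow> A \<subseteq> Univ N \<and> h ` A \<subseteq> Univ N \<and>
     (\<forall>\<phi> e. wf_fm L \<phi> \<and> e ` fv \<phi> \<subseteq> A \<longrightarrow> (sat N e \<phi> \<longleftrightarrow> sat N (h \<circ> e) \<phi>))"

definition automorphism ::
  "('f, 'r) lang \<Rightarrow> ('a, 'f, 'r) struct \<Rightarrow> ('a \<Rightarrow> 'a) \<Rightarrow> bool" where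
  "automorphism L N s \<longleftrightarrow> bij_betw s (Univ N) (Univ N) \<and>
     (\<forall>f xs. length xs = farity L f \<and> set xs \<subseteq> Univ N \<longrightarrow> s (Fun N f xs) = Fun N f (map s xs)) \<and>
     (\<forall>r xs. length xs = rarity L r \<and> set xs \<subseteq> Univ N \<longrightarrow> (Rel N r xs \<longleftrightarrow> Rel N r (map s xs)))"

definition strongly_homogeneous :: "('f, 'r) lang \<Rightarrow> 'k rel \<Rightarrow> ('a, 'f, 'r) struct \<Rightarrow> bool" where
  "strongly_homogeneous L \<kappa> N \<longleftrightarrow>
     (\<forall>A h. |A| <o \<kappa> \<and> elementary_map L N A h \<longrightarrow>
        (\<exists>s. automorphism L N s \<and> (\<forall>x \<in> A. s x = h x)))"

text \<open>The number of formulas is \<open>|L| + \<aleph>\<^sub>0\<close>, so \<open>\<kappa>\<close> is an uncountable cardinal greater than \<open>|L|\<close>.\<close>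

definition monster_model ::
  "('f, 'r) lang \<Rightarrow> 'k rel \<Rightarrow> ('f, 'r) fm set \<Rightarrow> ('a, 'f, 'r) struct \<Rightarrow> bool" where
  "monster_model L \<kappa> T N \<longleftrightarrow>
     Card_order \<kappa> \<and> |UNIV :: ('f, 'r) fm set| <o \<kappa> \<and>
     is_model L N T \<and> saturated L \<kappa> N \<and> strongly_homogeneous L \<kappa> N"


section \<open>C-minimal expansions of ACVF\<close>

definition ring_of :: "('a, 'f, 'r) struct \<Rightarrow> 'a ring" where
  "ring_of N = \<lparr>carrier = Univ N, monoid.mult = (\<lambda>x y. Fun N FMul [x, y]), one = Fun N FOne [],
     zero = Fun N FZero [], add = (\<lambda>x y. Fun N FAdd [x, y])\<rparr>"

definition vdiv :: "('a, 'f, 'r) struct \<Rightarrow> 'a \<Rightarrow> 'a \<Rightarrow> bool" where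
  "vdiv N x y \<longleftrightarrow> Rel N RDiv [x, y]"

text \<open>Algebraically closed fields with a non-trivial valuation, the latter being presented by the
  relation \<open>v x \<le> v y\<close>.\<close>

definition acvf :: "('a, 'f, 'r) struct \<Rightarrow> bool" where
  "acvf N \<longleftrightarrow> (let K = ring_of N; D = Univ N in
     algebraically_closed K \<and>
     (\<forall>x \<in> D. Fun N FNeg [x] = \<ominus>\<^bsub>K\<^esub> x) \<and>
     (\<forall>x \<in> D. \<forall>y \<in> D. vdiv N x y \<or> vdiv N y x) \<and>
     (\<forall>x \<in> D. \<forall>y \<in> D. \<forall>z \<in> D. vdiv N x y \<and> vdiv N y z \<longrightarrow> vdiv N x z) \<and>
     (\<forall>x \<in> D. \<forall>y \<in> D. \<forall>z \<in> D. vdiv N x y \<longrightarrow> vdiv N (x \<otimes>\<^bsub>K\<^esub> z) (y \<otimes>\<^bsub>K\<^esub> z)) \<and>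
     (\<forall>x \<in> D. \<forall>y \<in> D. \<forall>z \<in> D. vdiv N x y \<and> vdiv N x z \<longrightarrow> vdiv N x (y \<oplus>\<^bsub>K\<^esub> z)) \<and>
     (\<forall>x \<in> D. vdiv N \<zero>\<^bsub>K\<^esub> x \<longrightarrow> x = \<zero>\<^bsub>K\<^esub>) \<and>
     (\<exists>x \<in> D. x \<noteq> \<zero>\<^bsub>K\<^esub> \<and> \<not> vdiv N x \<one>\<^bsub>K\<^esub>))"

text \<open>The closed ball \<open>v (x - c) \<ge> v d\<close> and the open ball \<open>v (x - c) > v d\<close>.\<close>

definition struct_balls :: "('a, 'f, 'r) struct \<Rightarrow> 'a set set" where
  "struct_balls N =
     {{x \<in> Univ N. vdiv N d (x \<ominus>\<^bsub>ring_of N\<^esub> c)} | c d. c \<in> Univ N \<and> d \<in> Univ N - {\<zero>\<^bsub>ring_of N\<^esub>}} \<union>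
     {{x \<in> Univ N. \<not> vdiv N (x \<ominus>\<^bsub>ring_of N\<^esub> c) d} | c d. c \<in> Univ N \<and> d \<in> Univ N - {\<zero>\<^bsub>ring_of N\<^esub>}}"

inductive_set boolean_combinations :: "'a set \<Rightarrow> 'a set set \<Rightarrow> 'a set set"
  for D :: "'a set" and G :: "'a set set" where
  generator: "B \<in> G \<Longrightarrow> B \<in> boolean_combinations D G"
| complement: "B \<in> boolean_combinations D G \<Longrightarrow> D - B \<in> boolean_combinations D G"
| union: "B \<in> boolean_combinations D G \<Longrightarrow> C \<in> boolean_combinations D G \<Longrightarrow>
    B \<union> C \<in> boolean_combinations D G"

definition c_minimal :: "('f, 'r) lang \<Rightarrow> ('a, 'f, 'r) struct \<Rightarrow> bool" where
  "c_minimal L N \<longleftrightarrow> (\<forall>S. definable L N 1 ((\<lambda>x. [x]) ` S) \<longrightarrow>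
     S \<in> boolean_combinations (Univ N) (struct_balls N \<union> {{x} | x. x \<in> Univ N}))"

definition complete_c_minimal_acvf_expansion ::
  "'a itself \<Rightarrow> ('f, 'r) lang \<Rightarrow> ('f, 'r) fm set \<Rightarrow> bool" where
  "complete_c_minimal_acvf_expansion A L T \<longleftrightarrow> complete_theory A L T \<and>
     (\<forall>N :: ('a, 'f, 'r) struct. is_model L N T \<longrightarrow> acvf N \<and> c_minimal L N)"


section \<open>Valued fields as type class instances\<close>

text \<open>The value \<open>+\<infinity>\<close> of 0 is \<open>Pinf\<close>; the value \<open>Minf\<close> of \<open>'g extended\<close> is never attained. The
  type \<open>'g\<close> is the value group.\<close>

definition is_valuation :: "('a::field \<Rightarrow> 'g::linordered_ab_group_add extended) \<Rightarrow> bool" where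
  "is_valuation v \<longleftrightarrow>
     v 0 = Pinf \<and> v ` (UNIV - {0}) = range Fin \<and>
     (\<forall>x y. v (x * y) = v x + v y) \<and> (\<forall>x y. min (v x) (v y) \<le> v (x + y))"

text \<open>The universe of \<open>M\<close> is the type \<open>'a\<close>, and its valued field reduct is the field \<open>'a\<close> with
  the valuation \<open>v\<close>.\<close>

definition interprets_valued_field ::
  "('a::field, 'f, 'r) struct \<Rightarrow> ('a \<Rightarrow> 'g::linordered_ab_group_add extended) \<Rightarrow> bool" where
  "interprets_valued_field M v \<longleftrightarrow> is_valuation v \<and> Univ M = UNIV \<and>
     Fun M FZero [] = 0 \<and> Fun M FOne [] = 1 \<and>
     (\<forall>x y. Fun M FAdd [x, y] = x + y) \<and> (\<forall>x. Fun M FNeg [x] = - x) \<and>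
     (\<forall>x y. Fun M FMul [x, y] = x * y) \<and>
     (\<forall>x y. Rel M RDiv [x, y] \<longleftrightarrow> v x \<le> v y)"

definition closed_vball ::
  "('a::field \<Rightarrow> 'g::linordered_ab_group_add extended) \<Rightarrow> 'a \<Rightarrow> 'g \<Rightarrow> 'a set" where
  "closed_vball v c \<gamma> = {x. Fin \<gamma> \<le> v (x - c)}"

definition open_vball ::
  "('a::field \<Rightarrow> 'g::linordered_ab_group_add extended) \<Rightarrow> 'a \<Rightarrow> 'g \<Rightarrow> 'a set" where
  "open_vball v c \<gamma> = {x. Fin \<gamma> < v (x - c)}"

definition is_vball_of_radius ::
  "('a::field \<Rightarrow> 'g::linordered_ab_group_add extended) \<Rightarrow> 'a set \<Rightarrow> 'g \<Rightarrow> bool" where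
  "is_vball_of_radius v B \<gamma> \<longleftrightarrow> (\<exists>c. B = closed_vball v c \<gamma> \<or> B = open_vball v c \<gamma>)"

text \<open>A definable family of subsets of the home sort is given by a definable index set \<open>I \<subseteq> M\<^sup>k\<close>
  and a definable set \<open>S \<subseteq> M\<^sup>k\<^sup>+\<^sup>1\<close> whose fibres over \<open>I\<close> are the members of the family.\<close>

definition fibre :: "'a list set \<Rightarrow> 'a list \<Rightarrow> 'a set" where
  "fibre S i = {x. i @ [x] \<in> S}"

definition definably_complete ::
  "('f, 'r) lang \<Rightarrow> ('a::field, 'f, 'r) struct \<Rightarrow>
     ('a \<Rightarrow> 'g::linordered_ab_group_add extended) \<Rightarrow> bool" where
  "definably_complete L M v \<longleftrightarrow>
     (\<forall>k I S. definable L M k I \<and> definable L M (k + 1) S \<and>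
        (\<forall>i \<in> I. \<exists>\<gamma>. is_vball_of_radius v (fibre S i) \<gamma>) \<and>
        (\<forall>i \<in> I. \<forall>j \<in> I. fibre S i \<subseteq> fibre S j \<or> fibre S j \<subseteq> fibre S i) \<and>
        (\<forall>\<gamma>. \<exists>i \<in> I. \<exists>\<delta> \<ge> \<gamma>. is_vball_of_radius v (fibre S i) \<delta>)
        \<longrightarrow> (\<Inter>i \<in> I. fibre S i) \<noteq> {})"


section \<open>Topology and strict differentiability on \<open>M\<^sup>n\<close>\<close>

definition valuation_topology ::
  "('a::field \<Rightarrow> 'g::linordered_ab_group_add extended) \<Rightarrow> 'a topology" where
  "valuation_topology v = topology_generated_by {open_vball v c \<gamma> | c \<gamma>. True}"

text \<open>The library's product topology lives on \<open>'n \<Rightarrow> 'a\<close>; it is transported along the bijection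
  \<open>($)\<close>.\<close>

definition vec_topology ::
  "('a::field \<Rightarrow> 'g::linordered_ab_group_add extended) \<Rightarrow> ('a ^ 'n) topology" where
  "vec_topology v =
     pullback_topology UNIV (\<lambda>x i. x $ i) (product_topology (\<lambda>_. valuation_topology v) UNIV)"

definition vval ::
  "('a::field \<Rightarrow> 'g::linordered_ab_group_add extended) \<Rightarrow> 'a ^ 'n \<Rightarrow> 'g extended" where
  "vval v c = Min (range (\<lambda>i. v (c $ i)))"

text \<open>The coordinates of a vector, listed in some fixed order; which one is irrelevant, as
  definability is invariant under permutations of the coordinates.\<close>

definition coords :: "'a ^ 'n \<Rightarrow> 'a list" where
  "coords x = map (($) x) (SOME js. set js = UNIV \<and> distinct js)"

definition definable_vec_set ::
  "('f, 'r) lang \<Rightarrow> ('a, 'f, 'r) struct \<Rightarrow> ('a ^ 'n) set \<Rightarrow> bool" where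
  "definable_vec_set L M U \<longleftrightarrow> definable L M CARD('n) (coords ` U)"

definition definable_vec_fun ::
  "('f, 'r) lang \<Rightarrow> ('a, 'f, 'r) struct \<Rightarrow> ('a ^ 'n) set \<Rightarrow> ('a ^ 'n \<Rightarrow> 'a ^ 'm) \<Rightarrow> bool" where
  "definable_vec_fun L M U f \<longleftrightarrow>
     definable L M (CARD('n) + CARD('m)) ((\<lambda>x. coords x @ coords (f x)) ` U)"

text \<open>Strict differentiability of the restriction of \<open>f\<close> to \<open>U\<close>; values outside \<open>U\<close> are ignored.\<close>

definition has_strict_derivative ::
  "('a::field \<Rightarrow> 'g::linordered_ab_group_add extended) \<Rightarrow> ('a ^ 'n) set \<Rightarrow>
     ('a ^ 'n \<Rightarrow> 'a ^ 'm) \<Rightarrow> ('a ^ 'n \<Rightarrow> 'a ^ 'm) \<Rightarrow> 'a ^ 'n \<Rightarrow> bool" where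
  "has_strict_derivative v U f L a \<longleftrightarrow> a \<in> U \<and> Vector_Spaces.linear (*s) (*s) L \<and>
     (\<forall>\<gamma>. eventually
        (\<lambda>(x, y). x \<noteq> y \<longrightarrow> Fin \<gamma> < vval v (f x - f y - L (x - y)) - vval v (x - y))
        (nhdsin (prod_topology (subtopology (vec_topology v) U) (subtopology (vec_topology v) U))
           (a, a)))"

definition strictly_differentiable_on ::
  "('a::field \<Rightarrow> 'g::linordered_ab_group_add extended) \<Rightarrow> ('a ^ 'n) set \<Rightarrow>
     ('a ^ 'n \<Rightarrow> 'a ^ 'm) \<Rightarrow> bool" where
  "strictly_differentiable_on v U f \<longleftrightarrow> (\<forall>a \<in> U. \<exists>L. has_strict_derivative v U f L a)"

end

theory Submission
  imports Defs
begin

text \<open>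
  Strict differentiability at \<open>a\<close> makes the Newton step \<open>x \<mapsto> x + Df(a)\<inverse> (y - f x)\<close> raise the
  valuation of the residual \<open>y - f x\<close> by at least a fixed positive amount \<open>v t\<close> near \<open>a\<close>. As
  \<open>v t\<close> need not be cofinal in the value group, iteration does not converge. Instead, the set of
  values bounded by the valuation of some residual is definable, downward closed and invariant under
  adding \<open>v t\<close>, so by C-minimality it is the whole value group. The closed balls around \<open>x\<close> whose
  radius is the valuation of the (rescaled) residual at \<open>x\<close> therefore form a definable chain with
  radii tending to infinity, and by definable completeness, applied in each coordinate, they have
  a common point, which is a root of \<open>f x = y\<close>. The inverse map is Lipschitz because
  \<open>v (x - x') \<ge> v (f x - f x') + const\<close> near \<open>a\<close>; this bound also makes every nearby strict derivative
  injective, and inverting it gives the strict derivative of the inverse map.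
\<close>

section \<open>Definability\<close>

fun ren_tm :: "(nat \<Rightarrow> nat) \<Rightarrow> 'f tm \<Rightarrow> 'f tm" where
  "ren_tm \<rho> (TVar i) = TVar (\<rho> i)"
| "ren_tm \<rho> (TApp f ts) = TApp f (map (ren_tm \<rho>) ts)"

text \<open>Renamings need not be injective; later proofs use them to identify several indices.
  Under a quantifier the bound index 0 stays fixed and \<open>\<rho>\<close> acts on the shifted
  indices.\<close>

fun ren_fm :: "(nat \<Rightarrow> nat) \<Rightarrow> ('f, 'r) fm \<Rightarrow> ('f, 'r) fm" where
  "ren_fm \<rho> (FmEq s u) = FmEq (ren_tm \<rho> s) (ren_tm \<rho> u)"
| "ren_fm \<rho> (FmRel r ts) = FmRel r (map (ren_tm \<rho>) ts)"
| "ren_fm \<rho> (FmNot \<phi>) = FmNot (ren_fm \<rho> \<phi>)"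
| "ren_fm \<rho> (FmAnd \<phi> \<psi>) = FmAnd (ren_fm \<rho> \<phi>) (ren_fm \<rho> \<psi>)"
| "ren_fm \<rho> (FmEx \<phi>) = FmEx (ren_fm (case_nat 0 (Suc \<circ> \<rho>)) \<phi>)"

lemma wf_ren_tm [simp]: "wf_tm L (ren_tm \<rho> s) \<longleftrightarrow> wf_tm L s"
  by (induction s) auto

lemma wf_ren_fm [simp]: "wf_fm L (ren_fm \<rho> \<phi>) \<longleftrightarrow> wf_fm L \<phi>"
  by (induction \<phi> arbitrary: \<rho>) auto

lemma val_ren_tm: "val_tm N e (ren_tm \<rho> s) = val_tm N (e \<circ> \<rho>) s"
  by (induction s) (auto cong: map_cong simp: comp_def)

lemma sat_ren_fm: "sat N e (ren_fm \<rho> \<phi>) \<longleftrightarrow> sat N (e \<circ> \<rho>) \<phi>"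
proof (induction \<phi> arbitrary: \<rho> e)
  case (FmRel r ts)
  have "map (val_tm N e) (map (ren_tm \<rho>) ts) = map (val_tm N (e \<circ> \<rho>)) ts"
    by (simp add: val_ren_tm)
  then show ?case by (metis ren_fm.simps(2) sat.simps(2))
next
  case (FmEx \<phi>)
  have "case_nat x e \<circ> case_nat 0 (Suc \<circ> \<rho>) = case_nat x (e \<circ> \<rho>)" for x
    by (auto simp: fun_eq_iff split: nat.split)
  then show ?case by (simp only: ren_fm.simps sat.simps FmEx)
qed (simp_all add: val_ren_tm)

text \<open>
  Formulas with parameters are treated as predicates on environments \<open>nat \<Rightarrow> 'a\<close>; \<open>\<sigma>\<close> tells for
  each de Bruijn index whether it is a variable of the environment or a parameter.
\<close>

definition definable_term ::
  "('f, 'r) lang \<Rightarrow> ('a, 'f, 'r) struct \<Rightarrow> ((nat \<Rightarrow> 'a) \<Rightarrow> 'a) \<Rightarrow> bool" where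
  "definable_term L N F \<longleftrightarrow> (\<exists>s \<sigma>. wf_tm L s \<and>
     (\<forall>e. F e = val_tm N (case_sum e id \<circ> \<sigma>) s))"

definition definable_pred ::
  "('f, 'r) lang \<Rightarrow> ('a, 'f, 'r) struct \<Rightarrow> ((nat \<Rightarrow> 'a) \<Rightarrow> bool) \<Rightarrow> bool" where
  "definable_pred L N P \<longleftrightarrow> (\<exists>\<phi> \<sigma>. wf_fm L \<phi> \<and>
     (\<forall>e. P e \<longleftrightarrow> sat N (case_sum e id \<circ> \<sigma>) \<phi>))"

section \<open>Closure properties of definable terms and predicates\<close>

lemma definable_term_var: "definable_term L N (\<lambda>e. e i)"
  unfolding definable_term_def
  by (intro exI[of _ "TVar 0"] exI[of _ "\<lambda>_. Inl i"]) simp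

lemma definable_term_const: "definable_term L N (\<lambda>_. c)"
  unfolding definable_term_def
  by (intro exI[of _ "TVar 0"] exI[of _ "\<lambda>_. Inr c"]) simp

text \<open>Two formulas come with unrelated assignments. Storing one at the even and the other at
  the odd indices gives them a common assignment, once the formulas are renamed accordingly.\<close>

lemma merge_assignments:
  fixes \<sigma>\<^sub>1 \<sigma>\<^sub>2 :: "nat \<Rightarrow> 'b"
  obtains \<sigma> where "\<sigma>\<^sub>1 = \<sigma> \<circ> (\<lambda>i. 2 * i)" "\<sigma>\<^sub>2 = \<sigma> \<circ> (\<lambda>i. Suc (2 * i))"
proof
  let ?s = "\<lambda>i. if even i then \<sigma>\<^sub>1 (i div 2) else \<sigma>\<^sub>2 (i div 2)"
  show "\<sigma>\<^sub>1 = ?s \<circ> (\<lambda>i. 2 * i)" "\<sigma>\<^sub>2 = ?s \<circ> (\<lambda>i. Suc (2 * i))"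
    by (auto simp: fun_eq_iff)
qed

lemma definable_term_pairE:
  assumes "definable_term L N F" "definable_term L N G"
  obtains s u \<sigma> where "wf_tm L s" "wf_tm L u"
    "\<And>e. F e = val_tm N (case_sum e id \<circ> \<sigma>) s"
    "\<And>e. G e = val_tm N (case_sum e id \<circ> \<sigma>) u"
proof -
  from assms obtain s u \<sigma>\<^sub>1 \<sigma>\<^sub>2 where wf: "wf_tm L s" "wf_tm L u"
    and s: "\<And>e. F e = val_tm N (case_sum e id \<circ> \<sigma>\<^sub>1) s"
    and u: "\<And>e. G e = val_tm N (case_sum e id \<circ> \<sigma>\<^sub>2) u"
    unfolding definable_term_def by blast
  obtain \<sigma> where "\<sigma>\<^sub>1 = \<sigma> \<circ> (\<lambda>i. 2 * i)" "\<sigma>\<^sub>2 = \<sigma> \<circ> (\<lambda>i. Suc (2 * i))"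
    by (rule merge_assignments)
  then have "F e = val_tm N (case_sum e id \<circ> \<sigma>) (ren_tm (\<lambda>i. 2 * i) s)"
    "G e = val_tm N (case_sum e id \<circ> \<sigma>) (ren_tm (\<lambda>i. Suc (2 * i)) u)" for e
    by (simp_all add: s u val_ren_tm comp_assoc)
  with wf show thesis by (intro that) simp_all
qed

lemma definable_term_app2:
  assumes "farity L h = 2" "definable_term L N F" "definable_term L N G"
  shows "definable_term L N (\<lambda>e. Fun N h [F e, G e])"
proof -
  obtain s u \<sigma> where "wf_tm L s" "wf_tm L u"
    "\<And>e. F e = val_tm N (case_sum e id \<circ> \<sigma>) s"
    "\<And>e. G e = val_tm N (case_sum e id \<circ> \<sigma>) u"
    using definable_term_pairE[OF assms(2,3)] by blast
  then show ?thesis unfolding definable_term_def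
    by (intro exI[of _ "TApp h [s, u]"] exI[of _ \<sigma>]) (simp add: assms(1))
qed

lemma definable_term_app1:
  assumes "farity L h = 1" "definable_term L N F"
  shows "definable_term L N (\<lambda>e. Fun N h [F e])"
proof -
  obtain s \<sigma> where "wf_tm L s" "\<And>e. F e = val_tm N (case_sum e id \<circ> \<sigma>) s"
    using assms(2) unfolding definable_term_def by blast
  then show ?thesis unfolding definable_term_def
    by (intro exI[of _ "TApp h [s]"] exI[of _ \<sigma>]) (simp add: assms(1))
qed

lemma definable_pred_rel2:
  assumes "rarity L r = 2" "definable_term L N F" "definable_term L N G"
  shows "definable_pred L N (\<lambda>e. Rel N r [F e, G e])"
proof -
  obtain s u \<sigma> where "wf_tm L s" "wf_tm L u"
    "\<And>e. F e = val_tm N (case_sum e id \<circ> \<sigma>) s"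
    "\<And>e. G e = val_tm N (case_sum e id \<circ> \<sigma>) u"
    using definable_term_pairE[OF assms(2,3)] by blast
  then show ?thesis unfolding definable_pred_def
    by (intro exI[of _ "FmRel r [s, u]"] exI[of _ \<sigma>]) (simp add: assms(1))
qed

lemma definable_pred_True: "definable_pred L N (\<lambda>_. True)"
  unfolding definable_pred_def
  by (intro exI[of _ "FmEq (TVar 0) (TVar 0)"]) simp

lemma definable_pred_not:
  assumes "definable_pred L N P"
  shows "definable_pred L N (\<lambda>e. \<not> P e)"
proof -
  obtain \<phi> \<sigma> where "wf_fm L \<phi>" "\<And>e. P e \<longleftrightarrow> sat N (case_sum e id \<circ> \<sigma>) \<phi>"
    using assms unfolding definable_pred_def by blast
  then show ?thesis unfolding definable_pred_def
    by (intro exI[of _ "FmNot \<phi>"] exI[of _ \<sigma>]) simp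
qed

lemma definable_pred_conj:
  assumes "definable_pred L N P" "definable_pred L N Q"
  shows "definable_pred L N (\<lambda>e. P e \<and> Q e)"
proof -
  from assms obtain \<phi> \<psi> \<sigma>\<^sub>1 \<sigma>\<^sub>2 where wf: "wf_fm L \<phi>" "wf_fm L \<psi>"
    and P: "\<And>e. P e \<longleftrightarrow> sat N (case_sum e id \<circ> \<sigma>\<^sub>1) \<phi>"
    and Q: "\<And>e. Q e \<longleftrightarrow> sat N (case_sum e id \<circ> \<sigma>\<^sub>2) \<psi>"
    unfolding definable_pred_def by blast
  obtain \<sigma> where "\<sigma>\<^sub>1 = \<sigma> \<circ> (\<lambda>i. 2 * i)" "\<sigma>\<^sub>2 = \<sigma> \<circ> (\<lambda>i. Suc (2 * i))"
    by (rule merge_assignments)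
  with wf P Q show ?thesis unfolding definable_pred_def
    by (intro exI[of _ "FmAnd (ren_fm (\<lambda>i. 2 * i) \<phi>) (ren_fm (\<lambda>i. Suc (2 * i)) \<psi>)"] exI[of _ \<sigma>])
      (simp add: sat_ren_fm comp_assoc)
qed

lemma definable_pred_Ball:
  assumes "finite A" "\<And>i. i \<in> A \<Longrightarrow> definable_pred L N (P i)"
  shows "definable_pred L N (\<lambda>e. \<forall>i\<in>A. P i e)"
  using assms by (induction A) (simp_all add: definable_pred_True definable_pred_conj)

lemma definable_pred_all_finite:
  fixes P :: "'n::finite \<Rightarrow> _"
  assumes "\<And>i. definable_pred L N (P i)"
  shows "definable_pred L N (\<lambda>e. \<forall>i. P i e)"
  using definable_pred_Ball[of UNIV L N P] assms by simp

lemma definable_pred_ex_finite: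
  fixes P :: "'n::finite \<Rightarrow> _"
  assumes "\<And>i. definable_pred L N (P i)"
  shows "definable_pred L N (\<lambda>e. \<exists>i. P i e)"
  using definable_pred_not[OF definable_pred_all_finite[OF definable_pred_not[OF assms]]] by simp

text \<open>The formula stays the same; only the environment variables to which
  \<open>\<sigma>\<close> refers are renamed.\<close>

lemma definable_pred_subst:
  assumes "definable_pred L N P"
  shows "definable_pred L N (\<lambda>e. P (e \<circ> \<rho>))"
proof -
  obtain \<phi> \<sigma> where "wf_fm L \<phi>" "\<And>e. P e \<longleftrightarrow> sat N (case_sum e id \<circ> \<sigma>) \<phi>"
    using assms unfolding definable_pred_def by blast
  moreover have "case_sum (e \<circ> \<rho>) id \<circ> \<sigma> = case_sum e id \<circ> (map_sum \<rho> id \<circ> \<sigma>)" for e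
    by (auto simp: fun_eq_iff map_sum_def split: sum.split)
  ultimately show ?thesis unfolding definable_pred_def
    by (intro exI[of _ \<phi>] exI[of _ "map_sum \<rho> id \<circ> \<sigma>"]) simp
qed

lemma definable_pred_ex:
  assumes "Univ N = UNIV" "definable_pred L N P"
  shows "definable_pred L N (\<lambda>e. \<exists>x. P (e(j := x)))"
proof -
  obtain \<phi> \<sigma> where wf: "wf_fm L \<phi>" and P: "\<And>e. P e \<longleftrightarrow> sat N (case_sum e id \<circ> \<sigma>) \<phi>"
    using assms unfolding definable_pred_def by blast
  \<comment> \<open>Every index that stands for the environment variable \<open>j\<close> is
    identified with the newly bound index 0; all others move past the binder.\<close>
  define \<rho> where "\<rho> i = (if \<sigma> i = Inl j then 0 else Suc i)" for i
  have "case_nat x (case_sum e id \<circ> \<sigma>) \<circ> \<rho> = case_sum (e(j := x)) id \<circ> \<sigma>" for x e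
    by (auto simp: fun_eq_iff \<rho>_def split: sum.split)
  then show ?thesis using wf assms(1) unfolding definable_pred_def
    by (intro exI[of _ "FmEx (ren_fm \<rho> \<phi>)"] exI[of _ \<sigma>]) (simp add: P sat_ren_fm)
qed

text \<open>Serves in \<open>newton_root\<close> to quantify over a point together with its image
  under \<open>f\<close>.\<close>

lemma definable_pred_ex_many:
  assumes "Univ N = UNIV" "definable_pred L N P"
  shows "definable_pred L N (\<lambda>e. \<exists>w. P (\<lambda>i. if i < m then w i else e i))"
proof (induction m)
  case 0
  then show ?case using assms(2) by simp
next
  case (Suc m)
  have "(\<exists>w. P (\<lambda>i. if i < Suc m then w i else e i)) \<longleftrightarrow>
    (\<exists>x w. P (\<lambda>i. if i < m then w i else (e(m := x)) i))" for e
  proof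
    assume "\<exists>w. P (\<lambda>i. if i < Suc m then w i else e i)"
    then obtain w where "P (\<lambda>i. if i < Suc m then w i else e i)" by blast
    moreover have "(\<lambda>i. if i < Suc m then w i else e i) =
      (\<lambda>i. if i < m then w i else (e(m := w m)) i)" by auto
    ultimately show "\<exists>x w. P (\<lambda>i. if i < m then w i else (e(m := x)) i)" by metis
  next
    assume "\<exists>x w. P (\<lambda>i. if i < m then w i else (e(m := x)) i)"
    then obtain x w where "P (\<lambda>i. if i < m then w i else (e(m := x)) i)" by blast
    moreover have "(\<lambda>i. if i < m then w i else (e(m := x)) i) =
      (\<lambda>i. if i < Suc m then (w(m := x)) i else e i)" by auto
    ultimately show "\<exists>w. P (\<lambda>i. if i < Suc m then w i else e i)" by metis
  qed
  with definable_pred_ex[OF assms(1) Suc, of m] show ?case by simp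
qed

section \<open>From definable sets to definable predicates and back\<close>

lemma definable_imp_definable_pred:
  assumes "Univ N = UNIV" "definable L N k S"
  shows "definable_pred L N (\<lambda>e. map e [0..<k] \<in> S)"
proof -
  obtain \<phi> e\<^sub>0 where wf: "wf_fm L \<phi>" and S: "S = {xs. length xs = k \<and> set xs \<subseteq> Univ N \<and>
      sat N (\<lambda>i. if i < k then xs ! i else e\<^sub>0 i) \<phi>}"
    using assms unfolding definable_def by blast
  have "(\<lambda>i. if i < k then map e [0..<k] ! i else e\<^sub>0 i) =
    case_sum e id \<circ> (\<lambda>i. if i < k then Inl i else Inr (e\<^sub>0 i))" for e
    by (auto simp: fun_eq_iff)
  with wf show ?thesis unfolding definable_pred_def S
    by (intro exI[of _ \<phi>] exI[of _ "\<lambda>i. if i < k then Inl i else Inr (e\<^sub>0 i)"])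
      (simp add: assms(1))
qed

lemma definable_pred_imp_definable:
  assumes "Univ N = UNIV" "definable_pred L N P"
    and S: "\<And>xs. xs \<in> S \<Longrightarrow> length xs = k" "\<And>e. map e [0..<k] \<in> S \<longleftrightarrow> P e"
  shows "definable L N k S"
proof -
  obtain \<phi> \<sigma> where wf: "wf_fm L \<phi>" and P: "\<And>e. P e \<longleftrightarrow> sat N (case_sum e id \<circ> \<sigma>) \<phi>"
    using assms unfolding definable_pred_def by blast
  \<comment> \<open>\<open>definable\<close> keeps its parameters at the indices from
    \<open>k\<close> on, so a parameter at index \<open>i\<close> moves to \<open>k + i\<close>. By
    \<open>S(2)\<close> the predicate depends only on the first \<open>k\<close> entries of the
    environment, so all further variables may share the index \<open>k\<close>.\<close>
  define \<rho> where "\<rho> i = (case \<sigma> i of Inl j \<Rightarrow> if j < k then j else k | Inr c \<Rightarrow> k + i)" for i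
  define e\<^sub>0 :: "nat \<Rightarrow> 'a" where "e\<^sub>0 i = (case \<sigma> (i - k) of Inl j \<Rightarrow> undefined | Inr c \<Rightarrow> c)" for i
  have "xs \<in> S \<longleftrightarrow> sat N (\<lambda>i. if i < k then xs ! i else e\<^sub>0 i) (ren_fm \<rho> \<phi>)"
    if xs: "length xs = k" for xs
  proof -
    \<comment> \<open>The entries from \<open>k\<close> on can be chosen freely;
      \<open>e\<^sub>0 k\<close> is the value found at the index to which \<open>\<rho>\<close>
      sends them.\<close>
    define e where "e i = (if i < k then xs ! i else e\<^sub>0 k)" for i
    have "map e [0..<k] = xs" using xs by (intro nth_equalityI) (auto simp: e_def)
    then have "xs \<in> S \<longleftrightarrow> sat N (case_sum e id \<circ> \<sigma>) \<phi>" using S(2)[of e] P by simp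
    also have "case_sum e id \<circ> \<sigma> = (\<lambda>i. if i < k then xs ! i else e\<^sub>0 i) \<circ> \<rho>"
      by (auto simp: fun_eq_iff \<rho>_def e_def e\<^sub>0_def split: sum.split)
    finally show ?thesis by (simp only: sat_ren_fm)
  qed
  then show ?thesis unfolding definable_def using wf S(1) assms(1)
    by (intro exI[of _ "ren_fm \<rho> \<phi>"] exI[of _ e\<^sub>0]) auto
qed

section \<open>Valuations and the ultrametric topology\<close>

locale valued =
  fixes v :: "'a::field \<Rightarrow> 'g::linordered_ab_group_add extended"
  assumes valuation: "is_valuation v"
begin

section \<open>Arithmetic of the valuation\<close>

lemma v_zero [simp]: "v 0 = Pinf"
  and v_mult: "v (x * y) = v x + v y"
  and v_add: "min (v x) (v y) \<le> v (x + y)"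
  and v_image: "v ` (UNIV - {0}) = range Fin"
  using valuation unfolding is_valuation_def by auto

lemma v_Fin: "x \<noteq> 0 \<Longrightarrow> \<exists>\<gamma>. v x = Fin \<gamma>"
  using v_image by blast

lemma v_surj: "\<exists>x. x \<noteq> 0 \<and> v x = Fin \<gamma>"
proof -
  have "Fin \<gamma> \<in> v ` (UNIV - {0})" by (simp add: v_image)
  then show ?thesis by fastforce
qed

lemma v_eq_Pinf [simp]: "v x = Pinf \<longleftrightarrow> x = 0"
  using v_Fin[of x] by fastforce

lemma v_less_Pinf [simp]: "v x < Pinf \<longleftrightarrow> x \<noteq> 0"
  using v_Fin[of x] by fastforce

lemma v_one [simp]: "v 1 = 0"
proof -
  obtain \<gamma> where "v 1 = Fin \<gamma>" using v_Fin[of 1] by auto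
  moreover from this v_mult[of 1 1] have "Fin (\<gamma> + \<gamma>) = Fin \<gamma>" by simp
  ultimately show ?thesis by (simp add: zero_extended_def)
qed

lemma ex_upper_value: "x \<noteq> 0 \<Longrightarrow> y \<noteq> 0 \<Longrightarrow> \<exists>z. z \<noteq> 0 \<and> v x \<le> v z \<and> v y \<le> v z"
  using linear[of "v x" "v y"] by blast

lemma ex_lower_value: "x \<noteq> 0 \<Longrightarrow> y \<noteq> 0 \<Longrightarrow> \<exists>z. z \<noteq> 0 \<and> v z \<le> v x \<and> v z \<le> v y"
  using linear[of "v x" "v y"] by blast

text \<open>A linearly ordered group is torsion free, so \<open>v (- 1)\<close>, whose double is
  \<open>v 1 = 0\<close>, is itself 0.\<close>

lemma v_minus [simp]: "v (- x) = v x"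
proof -
  obtain \<gamma> where \<gamma>: "v (- 1) = Fin \<gamma>" using v_Fin[of "- 1"] by auto
  with v_mult[of "- 1" "- 1"] have "Fin (\<gamma> + \<gamma>) = Fin 0" by (simp add: zero_extended_def)
  then have "\<gamma> = 0" by simp
  with \<gamma> v_mult[of "- 1" x] show ?thesis by (cases "v x") simp_all
qed

lemma v_mult_le_iff [simp]: "c \<noteq> 0 \<Longrightarrow> v (c * x) \<le> v (c * y) \<longleftrightarrow> v x \<le> v y"
  using v_Fin[of c] by (cases "v x"; cases "v y") (auto simp: v_mult)

lemma v_mult_less_iff [simp]: "c \<noteq> 0 \<Longrightarrow> v (c * x) < v (c * y) \<longleftrightarrow> v x < v y"
  by (simp flip: not_le)

lemma v_mult_mono: "v x \<le> v y \<Longrightarrow> v (c * x) \<le> v (c * y)"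
  by (cases "c = 0") simp_all

lemma v_mult_mono_right: "v x \<le> v y \<Longrightarrow> v (x * c) \<le> v (y * c)"
  using v_mult_mono[of x y c] by (simp add: mult.commute)

lemma v_sum:
  assumes "finite A" "\<And>i. i \<in> A \<Longrightarrow> \<gamma> \<le> v (g i)"
  shows "\<gamma> \<le> v (sum g A)"
  using assms
proof (induction A)
  case (insert i A)
  then have "\<gamma> \<le> min (v (g i)) (v (sum g A))" by simp
  also have "\<dots> \<le> v (g i + sum g A)" by (rule v_add)
  finally show ?case using insert by simp
qed simp

section \<open>The minimum valuation on tuples\<close>

lemma le_vval_iff: "\<gamma> \<le> vval v x \<longleftrightarrow> (\<forall>i. \<gamma> \<le> v (x $ i))"
  unfolding vval_def by (subst Min_ge_iff) auto

lemma less_vval_iff: "\<gamma> < vval v x \<longleftrightarrow> (\<forall>i. \<gamma> < v (x $ i))"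
  unfolding vval_def by (subst Min_gr_iff) auto

lemma vval_le_iff: "vval v x \<le> \<gamma> \<longleftrightarrow> (\<exists>i. v (x $ i) \<le> \<gamma>)"
  unfolding vval_def by (subst Min_le_iff) auto

lemma vval_attained: "\<exists>i. vval v x = v (x $ i)"
proof -
  have "Min (range (\<lambda>i. v (x $ i))) \<in> range (\<lambda>i. v (x $ i))" by (rule Min_in) auto
  then show ?thesis unfolding vval_def by (rule rangeE) blast
qed

lemma vval_zero [simp]: "vval v 0 = Pinf"
  by (simp add: vval_def)

lemma vval_eq_Pinf [simp]: "vval v x = Pinf \<longleftrightarrow> x = 0"
  using le_vval_iff[of Pinf x] by (auto simp: vec_eq_iff)

lemma vval_Fin: "x \<noteq> 0 \<Longrightarrow> \<exists>\<gamma>. vval v x = Fin \<gamma>"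
  using vval_attained[of x] v_Fin by (metis v_zero vval_eq_Pinf)

lemma vval_minus [simp]: "vval v (- x) = vval v x"
  by (simp add: vval_def)

lemma vval_minus_commute: "vval v (x - y) = vval v (y - x)"
  using vval_minus[of "y - x"] by simp

lemma vval_add: "\<gamma> \<le> vval v x \<Longrightarrow> \<gamma> \<le> vval v y \<Longrightarrow> \<gamma> \<le> vval v (x + y)"
  unfolding le_vval_iff by (metis (no_types) min.boundedI order.trans v_add vector_add_component)

lemma vval_add_less: "\<gamma> < vval v x \<Longrightarrow> \<gamma> < vval v y \<Longrightarrow> \<gamma> < vval v (x + y)"
  unfolding less_vval_iff
  by (metis (no_types) min_less_iff_conj less_le_trans v_add vector_add_component)

lemma vval_diff: "\<gamma> \<le> vval v x \<Longrightarrow> \<gamma> \<le> vval v y \<Longrightarrow> \<gamma> \<le> vval v (x - y)"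
  using vval_add[of \<gamma> x "- y"] by simp

lemma vval_diff_less: "\<gamma> < vval v x \<Longrightarrow> \<gamma> < vval v y \<Longrightarrow> \<gamma> < vval v (x - y)"
  using vval_add_less[of \<gamma> x "- y"] by simp

lemma vval_scale: "vval v (c *s x) = v c + vval v x"
proof -
  obtain i where i: "vval v x = v (x $ i)" using vval_attained by blast
  have "vval v (c *s x) \<le> v (c * x $ i)" unfolding vval_le_iff by auto
  moreover have "v (c * x $ i) \<le> vval v (c *s x)"
    unfolding le_vval_iff using i le_vval_iff[of "vval v x" x] by (simp add: v_mult_mono)
  ultimately show ?thesis by (simp add: i v_mult)
qed

text \<open>One coordinate attains the minimum for all multiples of \<open>x\<close> at once, so
  comparisons of rescaled tuples reduce to comparisons of field elements.\<close>

lemma vval_scale_attained: "\<exists>i. vval v x = v (x $ i) \<and> (\<forall>c. vval v (c *s x) = v (c * x $ i))"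
proof -
  obtain i where "vval v x = v (x $ i)" using vval_attained by blast
  then show ?thesis by (intro exI[of _ i]) (simp add: vval_scale v_mult)
qed

lemma vval_scale_le_iff [simp]:
  assumes "c \<noteq> 0"
  shows "vval v (c *s x) \<le> vval v (c *s y) \<longleftrightarrow> vval v x \<le> vval v y"
proof -
  obtain i where i: "vval v x = v (x $ i)" "vval v (c *s x) = v (c * x $ i)"
    using vval_scale_attained by blast
  obtain j where j: "vval v y = v (y $ j)" "vval v (c *s y) = v (c * y $ j)"
    using vval_scale_attained by blast
  show ?thesis unfolding i j using assms by simp
qed

lemma vval_scale_less_iff [simp]: "c \<noteq> 0 \<Longrightarrow> vval v (c *s x) < vval v (c *s y) \<longleftrightarrow> vval v x < vval v y"
  by (simp flip: not_le)

lemma vval_scale_mono: "vval v x \<le> vval v y \<Longrightarrow> vval v (c *s x) \<le> vval v (c *s y)"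
  by (cases "c = 0") simp_all

lemma vval_scale_mono_left:
  assumes "v b \<le> v c"
  shows "vval v (b *s x) \<le> vval v (c *s x)"
proof -
  obtain i where i: "\<And>c. vval v (c *s x) = v (c * x $ i)"
    using vval_scale_attained by blast
  show ?thesis unfolding i using assms by (rule v_mult_mono_right)
qed

lemma scaled_less_iff:
  assumes "c \<noteq> 0"
  shows "v d < vval v (c *s x) \<longleftrightarrow> v (d / c) < vval v x"
proof -
  obtain i where i: "vval v x = v (x $ i)" "vval v (c *s x) = v (c * x $ i)"
    using vval_scale_attained by blast
  show ?thesis unfolding i using v_mult_less_iff[of c "d / c" "x $ i"] assms by simp
qed

text \<open>By the ultrametric inequality a matrix lowers values by no more than its entry of least
  value does.\<close>

lemma linear_lower_bound:
  fixes h :: "'a ^ 'n \<Rightarrow> 'a ^ 'm"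
  assumes "Vector_Spaces.linear (*s) (*s) h"
  obtains c where "c \<noteq> 0" "\<And>x. vval v (c *s x) \<le> vval v (h x)"
proof -
  \<comment> \<open>Removing 0 makes the chosen element nonzero; inserting 1 keeps the set nonempty
    for the zero matrix, and can only weaken the bound otherwise.\<close>
  let ?E = "insert 1 (range (\<lambda>(i, j). matrix h $ i $ j) - {0})"
  have "finite (v ` ?E)" "v ` ?E \<noteq> {}" by auto
  then have "Min (v ` ?E) \<in> v ` ?E" and le: "\<And>b. b \<in> ?E \<Longrightarrow> Min (v ` ?E) \<le> v b"
    by (rule Min_in, intro Min_le) auto
  then obtain c where c: "c \<in> ?E" "\<And>b. b \<in> ?E \<Longrightarrow> v c \<le> v b"
    by (metis (no_types, lifting) imageE)
  have entry: "v c \<le> v (matrix h $ i $ j)" for i j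
    proof (cases "matrix h $ i $ j = 0")
    case False
    moreover have "matrix h $ i $ j \<in> range (\<lambda>(i, j). matrix h $ i $ j)"
      by (rule range_eqI[of _ _ "(i, j)"]) simp
    ultimately show ?thesis using c(2) by blast
  qed simp
  show thesis
  proof
    show "c \<noteq> 0" using c(1) by auto
    fix x
    have "vval v (c *s x) \<le> v (h x $ i)" for i
    proof -
      have "h x $ i = (\<Sum>j\<in>UNIV. matrix h $ i $ j * x $ j)"
        by (subst matrix_works[OF assms, symmetric]) (simp add: matrix_vector_mult_def)
      moreover have "vval v (c *s x) \<le> v (matrix h $ i $ j * x $ j)" for j
      proof -
        have "vval v (c *s x) \<le> v (c * x $ j)" unfolding vval_le_iff by auto
        also have "\<dots> \<le> v (matrix h $ i $ j * x $ j)" by (rule v_mult_mono_right[OF entry])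
        finally show ?thesis .
      qed
      ultimately show ?thesis by (simp add: v_sum)
    qed
    then show "vval v (c *s x) \<le> vval v (h x)" by (simp add: le_vval_iff)
  qed
qed

text \<open>Radii of balls in \<open>M\<^sup>n\<close> are given by field elements rather than by their values, so that
  rescaling needs no arithmetic in the value group.\<close>

definition vball :: "'a ^ 'n \<Rightarrow> 'a \<Rightarrow> ('a ^ 'n) set" where
  "vball a d = {x. v d < vval v (x - a)}"

lemma vball_centre [simp]: "a \<in> vball a d \<longleftrightarrow> d \<noteq> 0"
  by (simp add: vball_def)

lemma vball_mono: "v d \<le> v d' \<Longrightarrow> vball a d' \<subseteq> vball a d"
  unfolding vball_def by auto

section \<open>Balls as a base of the topologies\<close>

lemma openin_valuation_topology:
  "openin (valuation_topology v) W \<longleftrightarrow> (\<forall>a\<in>W. \<exists>\<gamma>. open_vball v a \<gamma> \<subseteq> W)"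
proof
  assume "openin (valuation_topology v) W"
  then have "generate_topology_on {open_vball v c \<gamma> | c \<gamma>. True} W"
    unfolding valuation_topology_def by (rule openin_topology_generated_by)
  then show "\<forall>a\<in>W. \<exists>\<gamma>. open_vball v a \<gamma> \<subseteq> W"
  proof induction
    case (Int S Y)
    show ?case
    proof
      fix a assume "a \<in> S \<inter> Y"
      with Int obtain \<gamma> \<delta> where "open_vball v a \<gamma> \<subseteq> S" "open_vball v a \<delta> \<subseteq> Y" by blast
      moreover have "open_vball v a (max \<gamma> \<delta>) \<subseteq> open_vball v a \<gamma> \<inter> open_vball v a \<delta>"
        by (auto simp: open_vball_def) (metis max_extended_simps(1) max_less_iff_conj)+
      ultimately show "\<exists>\<gamma>. open_vball v a \<gamma> \<subseteq> S \<inter> Y" by blast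
    qed
  next
    case (UN K)
    then show ?case by blast
  next
    case (Basis S)
    then obtain c \<gamma> where S: "S = open_vball v c \<gamma>" by blast
    \<comment> \<open>By the ultrametric inequality every point of a ball is a centre of it.\<close>
    have "open_vball v a \<gamma> \<subseteq> S" if a: "a \<in> S" for a
    proof
      fix x assume "x \<in> open_vball v a \<gamma>"
      with a have "Fin \<gamma> < min (v (x - a)) (v (a - c))" by (simp add: open_vball_def S)
      also have "\<dots> \<le> v (x - c)" using v_add[of "x - a" "a - c"] by simp
      finally show "x \<in> S" by (simp add: open_vball_def S)
    qed
    then show ?case by blast
  qed simp
next
  assume *: "\<forall>a\<in>W. \<exists>\<gamma>. open_vball v a \<gamma> \<subseteq> W"
  show "openin (valuation_topology v) W"
  proof (subst openin_subopen, intro ballI)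
    fix a assume "a \<in> W"
    with * obtain \<gamma> where "open_vball v a \<gamma> \<subseteq> W" by blast
    moreover have "openin (valuation_topology v) (open_vball v a \<gamma>)"
      unfolding valuation_topology_def by (intro topology_generated_by_Basis) blast
    moreover have "a \<in> open_vball v a \<gamma>" by (simp add: open_vball_def)
    ultimately show "\<exists>T. openin (valuation_topology v) T \<and> a \<in> T \<and> T \<subseteq> W" by blast
  qed
qed

lemma topspace_valuation_topology [simp]: "topspace (valuation_topology v) = UNIV"
  using openin_subset[of "valuation_topology v" UNIV] by (auto simp: openin_valuation_topology)

lemma topspace_vec_topology [simp]: "topspace (vec_topology v) = UNIV"
  unfolding vec_topology_def by (simp add: topspace_pullback_topology)

lemma openin_vball: "openin (vec_topology v) (vball (a :: 'a ^ 'n) d)"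
proof (cases "d = 0")
  case False
  then obtain \<gamma> where d: "v d = Fin \<gamma>" using v_Fin by blast
  have "openin (product_topology (\<lambda>_::'n. valuation_topology v) UNIV)
      (Pi\<^sub>E UNIV (\<lambda>i. open_vball v (a $ i) \<gamma>))"
    unfolding valuation_topology_def
    by (auto simp: openin_PiE intro!: topology_generated_by_Basis)
  moreover have "vball a d = (\<lambda>x i. x $ i) -` (Pi\<^sub>E UNIV (\<lambda>i. open_vball v (a $ i) \<gamma>)) \<inter> UNIV"
    by (auto simp: vball_def open_vball_def PiE_iff less_vval_iff d)
  ultimately show ?thesis unfolding vec_topology_def openin_pullback_topology by blast
qed (simp add: vball_def)

lemma openin_vec_topology:
  fixes W :: "('a ^ 'n) set"
  shows "openin (vec_topology v) W \<longleftrightarrow> (\<forall>a\<in>W. \<exists>d. d \<noteq> 0 \<and> vball a d \<subseteq> W)"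
proof
  assume "openin (vec_topology v) W"
  then obtain S where S: "openin (product_topology (\<lambda>_::'n. valuation_topology v) UNIV) S"
    and W: "W = (\<lambda>x i. x $ i) -` S"
    unfolding vec_topology_def openin_pullback_topology by auto
  show "\<forall>a\<in>W. \<exists>d. d \<noteq> 0 \<and> vball a d \<subseteq> W"
  proof
    fix a assume "a \<in> W"
    then have "(\<lambda>i. a $ i) \<in> S" using W by simp
    with S obtain Y where Y: "\<And>i. openin (valuation_topology v) (Y i)"
      "(\<lambda>i. a $ i) \<in> Pi\<^sub>E UNIV Y" "Pi\<^sub>E UNIV Y \<subseteq> S"
      unfolding openin_product_topology_alt by (metis UNIV_I)
    then have "\<forall>i. \<exists>\<gamma>. open_vball v (a $ i) \<gamma> \<subseteq> Y i"
      by (auto simp: openin_valuation_topology PiE_iff)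
    then obtain \<gamma> where \<gamma>: "\<And>i. open_vball v (a $ i) (\<gamma> i) \<subseteq> Y i" by metis
    \<comment> \<open>There are finitely many coordinates, so the largest of their radii serves for
      all of them.\<close>
    obtain d where d: "d \<noteq> 0" "v d = Fin (Max (range \<gamma>))" using v_surj by blast
    have "vball a d \<subseteq> W"
    proof
      fix x assume "x \<in> vball a d"
      then have "Fin (Max (range \<gamma>)) < v (x $ i - a $ i)" for i
        by (simp add: vball_def less_vval_iff d)
      moreover have "Fin (\<gamma> i) \<le> Fin (Max (range \<gamma>))" for i by simp
      ultimately have "x $ i \<in> Y i" for i
        using \<gamma> le_less_trans unfolding open_vball_def by blast
      then show "x \<in> W" using Y(3) by (auto simp: W PiE_iff)
    qed
    with d show "\<exists>d. d \<noteq> 0 \<and> vball a d \<subseteq> W" by blast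
  qed
next
  assume *: "\<forall>a\<in>W. \<exists>d. d \<noteq> 0 \<and> vball a d \<subseteq> W"
  show "openin (vec_topology v) W"
  proof (subst openin_subopen, intro ballI)
    fix a assume "a \<in> W"
    with * obtain d where "d \<noteq> 0" "vball a d \<subseteq> W" by blast
    then show "\<exists>T. openin (vec_topology v) T \<and> a \<in> T \<and> T \<subseteq> W"
      using openin_vball[of a d] by (intro exI[of _ "vball a d"]) simp
  qed
qed

text \<open>The bound is a Lipschitz condition: \<open>h\<close> maps the points of \<open>S\<close>
  in the ball of radius \<open>d / c\<close> about \<open>x\<close> into the ball of radius
  \<open>d\<close> about \<open>h x\<close>.\<close>

lemma continuous_map_of_lower_bound:
  fixes S :: "('a ^ 'n) set" and h :: "'a ^ 'n \<Rightarrow> 'a ^ 'm"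
  assumes "c \<noteq> 0" and bound: "\<And>x y. x \<in> S \<Longrightarrow> y \<in> S \<Longrightarrow> vval v (c *s (x - y)) \<le> vval v (h x - h y)"
    and img: "h ` S \<subseteq> Y"
  shows "continuous_map (subtopology (vec_topology v) S) (subtopology (vec_topology v) Y) h"
proof (rule continuous_map_into_subtopology)
  show "h \<in> topspace (subtopology (vec_topology v) S) \<rightarrow> Y" using img by auto
  show "continuous_map (subtopology (vec_topology v) S) (vec_topology v) h"
    unfolding continuous_map_alt
  proof (intro conjI allI impI)
    fix W :: "('a ^ 'm) set" assume W: "openin (vec_topology v) W"
    have "\<exists>T. openin (subtopology (vec_topology v) S) T \<and> x \<in> T \<and>
        T \<subseteq> h -` W \<inter> topspace (subtopology (vec_topology v) S)"
      if "x \<in> h -` W \<inter> topspace (subtopology (vec_topology v) S)" for x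
    proof -
      from that have x: "x \<in> S" "h x \<in> W" by auto
      with W obtain d where d: "d \<noteq> 0" "vball (h x) d \<subseteq> W" by (auto simp: openin_vec_topology)
      have "S \<inter> vball x (d / c) \<subseteq> h -` W"
      proof
        fix y assume y: "y \<in> S \<inter> vball x (d / c)"
        then have "v (d / c) < vval v (y - x)" by (simp add: vball_def)
        then have "v d < vval v (c *s (y - x))"
          by (rule scaled_less_iff[OF \<open>c \<noteq> 0\<close>, THEN iffD2])
        also have "\<dots> \<le> vval v (h y - h x)" using y x by (intro bound) auto
        finally show "y \<in> h -` W" using d by (auto simp: vball_def)
      qed
      moreover have "openin (subtopology (vec_topology v) S) (S \<inter> vball x (d / c))"
        using openin_vball openin_subtopology_Int2 by blast
      ultimately show ?thesis using x d \<open>c \<noteq> 0\<close>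
        by (intro exI[of _ "S \<inter> vball x (d / c)"]) auto
    qed
    then show "openin (subtopology (vec_topology v) S)
        (h -` W \<inter> topspace (subtopology (vec_topology v) S))"
      by (subst openin_subopen) blast
  qed simp
qed

text \<open>The difference of values is replaced by rescaling with a field element \<open>c\<close>
  of value \<gamma>. Each neighbourhood of \<open>(a, a)\<close> contains a box, and the
  intersection of the two sides of the box contains a ball about \<open>a\<close>, so squares of
  balls suffice.\<close>

lemma has_strict_derivative_iff:
  fixes U :: "('a ^ 'n) set" and f :: "'a ^ 'n \<Rightarrow> 'a ^ 'm"
  assumes U: "openin (vec_topology v) U" "a \<in> U"
  shows "has_strict_derivative v U f h a \<longleftrightarrow> Vector_Spaces.linear (*s) (*s) h \<and>
    (\<forall>c. c \<noteq> 0 \<longrightarrow> (\<exists>d. d \<noteq> 0 \<and> vball a d \<subseteq> U \<and> (\<forall>x\<in>vball a d. \<forall>y\<in>vball a d. x \<noteq> y \<longrightarrow>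
      vval v (c *s (x - y)) < vval v (f x - f y - h (x - y)))))"
proof -
  \<comment> \<open>Since \<open>z\<close> is nonzero, its value is finite and can be moved across
    the inequality.\<close>
  have value_iff: "Fin \<gamma> < \<eta> - vval v z \<longleftrightarrow> vval v (c *s z) < \<eta>"
    if "v c = Fin \<gamma>" "z \<noteq> 0" for z :: "'a ^ 'n" and c \<gamma> \<eta>
    using vval_Fin[OF that(2)] that(1) by (cases \<eta>) (auto simp: vval_scale less_diff_eq)
  let ?T = "subtopology (vec_topology v) U"
  have "eventually P (nhdsin (prod_topology ?T ?T) (a, a)) \<longleftrightarrow>
    (\<exists>d. d \<noteq> 0 \<and> vball a d \<subseteq> U \<and> (\<forall>x\<in>vball a d. \<forall>y\<in>vball a d. P (x, y)))" (is "?l \<longleftrightarrow> ?r") for P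
  proof
    assume ?l
    moreover have "(a, a) \<in> topspace (prod_topology ?T ?T)" using U(2) by simp
    ultimately obtain Q where Q: "openin (prod_topology ?T ?T) Q" "(a, a) \<in> Q"
      and P: "\<And>p. p \<in> Q \<Longrightarrow> P p"
      unfolding eventually_nhdsin by blast
    from Q obtain S Y where XY: "openin ?T S" "openin ?T Y" "a \<in> S" "a \<in> Y" "S \<times> Y \<subseteq> Q"
      by (metis openin_prod_topology_alt[THEN iffD1, OF Q(1), rule_format, OF Q(2)])
    then have "openin (vec_topology v) S" "openin (vec_topology v) Y" "S \<subseteq> U"
      using U(1) by (simp_all add: openin_open_subtopology)
    then have SY: "openin (vec_topology v) (S \<inter> Y)" "S \<inter> Y \<subseteq> U" by auto
    have "\<exists>d. d \<noteq> 0 \<and> vball a d \<subseteq> S \<inter> Y"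
      by (rule openin_vec_topology[THEN iffD1, THEN bspec, OF SY(1)]) (use XY in simp)
    then obtain d where d: "d \<noteq> 0" "vball a d \<subseteq> S \<inter> Y" by blast
    from d(2) SY(2) have "vball a d \<subseteq> U" by (rule order.trans)
    have "P (x, y)" if "x \<in> vball a d" "y \<in> vball a d" for x y
      using that d(2) XY(5) by (intro P) auto
    with d(1) \<open>vball a d \<subseteq> U\<close> show ?r by (intro exI[of _ d]) simp
  next
    assume ?r
    then obtain d where d: "d \<noteq> 0" "vball a d \<subseteq> U" "\<forall>x\<in>vball a d. \<forall>y\<in>vball a d. P (x, y)" by blast
    have "openin ?T (vball a d)"
      using openin_vball d(2) by (simp add: openin_open_subtopology U(1))
    then have "openin (prod_topology ?T ?T) (vball a d \<times> vball a d)"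
      by (simp add: openin_prod_Times_iff)
    moreover have "(a, a) \<in> vball a d \<times> vball a d" "\<forall>p\<in>vball a d \<times> vball a d. P p"
      using d by auto
    ultimately show ?l unfolding eventually_nhdsin
      by (intro disjI2 exI[of _ "vball a d \<times> vball a d"]) simp
  qed
  note ev = this
  have main: "(\<forall>\<gamma>. \<exists>d. d \<noteq> 0 \<and> vball a d \<subseteq> U \<and> (\<forall>x\<in>vball a d. \<forall>y\<in>vball a d. x \<noteq> y \<longrightarrow>
      Fin \<gamma> < vval v (f x - f y - h (x - y)) - vval v (x - y))) \<longleftrightarrow>
    (\<forall>c. c \<noteq> 0 \<longrightarrow> (\<exists>d. d \<noteq> 0 \<and> vball a d \<subseteq> U \<and> (\<forall>x\<in>vball a d. \<forall>y\<in>vball a d. x \<noteq> y \<longrightarrow>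
      vval v (c *s (x - y)) < vval v (f x - f y - h (x - y)))))" (is "(\<forall>\<gamma>. ?A \<gamma>) \<longleftrightarrow> (\<forall>c. c \<noteq> 0 \<longrightarrow> ?B c)")
  proof -
    have AB: "?A \<gamma> \<longleftrightarrow> ?B c" if c: "v c = Fin \<gamma>" for c \<gamma>
    proof -
      have eq: "(x \<noteq> y \<longrightarrow> Fin \<gamma> < vval v (f x - f y - h (x - y)) - vval v (x - y)) \<longleftrightarrow>
        (x \<noteq> y \<longrightarrow> vval v (c *s (x - y)) < vval v (f x - f y - h (x - y)))" for x y
        by (rule imp_cong[OF refl], rule value_iff[OF c]) simp
      show ?thesis by (simp only: eq)
    qed
    show ?thesis
    proof (intro iffI allI impI)
      fix c :: 'a assume A: "\<forall>\<gamma>. ?A \<gamma>" and "c \<noteq> 0"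
      obtain \<gamma> where c: "v c = Fin \<gamma>" using v_Fin[OF \<open>c \<noteq> 0\<close>] by blast
      show "?B c" by (rule AB[OF c, THEN iffD1], rule A[THEN spec])
    next
      fix \<gamma> assume B: "\<forall>c. c \<noteq> 0 \<longrightarrow> ?B c"
      obtain c where c: "c \<noteq> 0" "v c = Fin \<gamma>" using v_surj by blast
      show "?A \<gamma>" by (rule AB[OF c(2), THEN iffD2], rule B[THEN spec, THEN mp, OF c(1)])
    qed
  qed
  show ?thesis unfolding has_strict_derivative_def ev prod.case main using U(2) by (simp only: simp_thms)
qed

end

section \<open>C-minimality and Newton's method\<close>

definition coord_list :: "'n::finite list" where
  "coord_list = (SOME js. set js = UNIV \<and> distinct js)"

lemma coords_eq_map: "coords x = map (($) x) coord_list"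
  by (simp only: coords_def coord_list_def)

lemma set_coord_list: "set (coord_list :: 'n::finite list) = UNIV"
  and distinct_coord_list: "distinct (coord_list :: 'n list)"
proof -
  obtain js :: "'n list" where "set js = UNIV" "distinct js"
    using finite_distinct_list[OF finite[of UNIV]] by blast
  then have "set js = UNIV \<and> distinct js" by simp
  then have "set (coord_list :: 'n list) = UNIV \<and> distinct (coord_list :: 'n list)"
    unfolding coord_list_def by (rule someI)
  then show "set (coord_list :: 'n list) = UNIV" "distinct (coord_list :: 'n list)"
    by (rule conjunct1, rule conjunct2)
qed

lemma length_coord_list [simp]: "length (coord_list :: 'n::finite list) = CARD('n)"
  using distinct_card[OF distinct_coord_list] set_coord_list by metis

lemma length_coords [simp]: "length (coords (x :: 'a ^ 'n)) = CARD('n)"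
  by (simp add: coords_eq_map)

definition coord_index :: "'n::finite \<Rightarrow> nat" where
  "coord_index i = (SOME k. k < CARD('n) \<and> coord_list ! k = i)"

lemma coord_index_less: "coord_index (i :: 'n::finite) < CARD('n)"
  and coord_list_nth_index [simp]: "coord_list ! coord_index i = i"
proof -
  have "i \<in> set coord_list" by (simp add: set_coord_list)
  then obtain k where "k < CARD('n)" "coord_list ! k = i" by (auto simp: in_set_conv_nth)
  then have "k < CARD('n) \<and> coord_list ! k = i" by simp
  then have "coord_index i < CARD('n) \<and> coord_list ! coord_index i = i"
    unfolding coord_index_def by (rule someI)
  then show "coord_index i < CARD('n)" "coord_list ! coord_index i = i"
    by (rule conjunct1, rule conjunct2)
qed

lemma coord_index_nth:
  assumes "k < CARD('n)"
  shows "coord_index (coord_list ! k :: 'n::finite) = k"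
  using nth_eq_iff_index_eq[OF distinct_coord_list[where 'n='n], of "coord_index (coord_list ! k :: 'n)" k]
    assms
  by (simp add: coord_index_less)

text \<open>Reads off a vector in the coordinate order of \<open>coords\<close>. In the formulas
  below a point starts at index 0, its image at \<open>CARD('n)\<close>, and a further scalar
  follows.\<close>

definition env_vec :: "nat \<Rightarrow> (nat \<Rightarrow> 'a) \<Rightarrow> 'a ^ 'n" where
  "env_vec m e = (\<chi> i. e (m + coord_index i))"

lemma env_vec_nth [simp]: "env_vec m e $ i = e (m + coord_index i)"
  by (simp add: env_vec_def)

lemma coords_nth: "coords (x :: 'a ^ 'n) ! coord_index i = x $ i"
  by (simp add: coords_eq_map coord_index_less)

lemma coords_eq_iff [simp]: "coords x = coords y \<longleftrightarrow> x = y"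
proof
  assume "coords x = coords y"
  then have "x $ i = y $ i" for i using coords_nth[of x i] coords_nth[of y i] by simp
  then show "x = y" by (simp add: vec_eq_iff)
qed simp

lemma coords_env_vec: "coords (env_vec m e :: 'a ^ 'n) = map e [m..<m + CARD('n)]"
  by (intro nth_equalityI) (simp_all add: coords_eq_map coord_index_nth)

lemma env_vec_coords [simp]:
  fixes x :: "'a ^ 'n" and z :: "'a ^ 'm"
  shows "env_vec 0 ((!) (coords x @ ys)) = x"
    and "env_vec CARD('n) ((!) (coords x @ coords z @ ys)) = z"
    and "(coords x @ coords z @ w # ys) ! (CARD('n) + CARD('m)) = w"
  by (simp_all add: vec_eq_iff nth_append coord_index_less coords_nth)

lemma env_vec_cong:
  assumes "\<And>i. i < m + CARD('n) \<Longrightarrow> e i = e' i"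
  shows "(env_vec m e :: 'a ^ 'n) = env_vec m e'"
  using assms by (simp add: vec_eq_iff coord_index_less)

lemma map_env_coords:
  "map e [0..<CARD('n) + CARD('m)] =
    coords (env_vec 0 e :: 'a ^ 'n) @ coords (env_vec CARD('n) e :: 'a ^ 'm)"
  by (simp only: coords_env_vec upt_add_eq_append[of 0 "CARD('n)", OF le0] map_append add_0)

lemma map_env_in_graph_iff:
  fixes f :: "'a ^ 'n \<Rightarrow> 'a ^ 'm"
  shows "map e [0..<CARD('n) + CARD('m)] \<in> (\<lambda>x. coords x @ coords (f x)) ` A \<longleftrightarrow>
    env_vec 0 e \<in> A \<and> env_vec CARD('n) e = f (env_vec 0 e)"
  unfolding map_env_coords by auto

section \<open>Definability over the valued field\<close>

locale definably_complete_field =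
  fixes L :: "('f, 'r) lang"
    and M :: "('a::field, 'f, 'r) struct"
    and v :: "'a \<Rightarrow> 'g::linordered_ab_group_add extended"
  assumes interp: "interprets_valued_field M v"
    and acvf: "acvf M"
    and c_min: "c_minimal L M"
    and complete: "definably_complete L M v"
begin

sublocale valued v
  using interp by unfold_locales (simp add: interprets_valued_field_def)

lemma Univ_M [simp]: "Univ M = UNIV"
  and Fun_M [simp]: "Fun M FZero [] = 0" "Fun M FOne [] = 1" "Fun M FAdd [x, y] = x + y"
    "Fun M FNeg [x] = - x" "Fun M FMul [x, y] = x * y"
  and Rel_M [simp]: "Rel M RDiv [x, y] \<longleftrightarrow> v x \<le> v y"
  using interp by (auto simp: interprets_valued_field_def)

text \<open>\<open>acvf\<close> identifies the negation symbol with the additive inverse of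
  \<open>ring_of M\<close>; this turns the members of \<open>struct_balls\<close> into balls for
  \<open>v\<close>.\<close>

lemma ring_of_minus [simp]: "x \<ominus>\<^bsub>ring_of M\<^esub> y = x - y"
proof -
  have "Fun M FNeg [y] = \<ominus>\<^bsub>ring_of M\<^esub> y"
    using acvf by (simp add: acvf_def Let_def)
  then have "\<ominus>\<^bsub>ring_of M\<^esub> y = - y" by simp
  then show ?thesis by (simp add: a_minus_def ring_of_def)
qed

text \<open>The non-triviality clause of \<open>acvf\<close> gives an element whose value is not at
  most \<open>v 1 = 0\<close>.\<close>

lemma ex_positive_value: "\<exists>t. t \<noteq> 0 \<and> 0 < v t"
proof -
  have "\<exists>x\<in>Univ M. x \<noteq> \<zero>\<^bsub>ring_of M\<^esub> \<and> \<not> vdiv M x \<one>\<^bsub>ring_of M\<^esub>"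
    using acvf by (simp only: acvf_def Let_def)
  then show ?thesis by (auto simp: ring_of_def vdiv_def)
qed

lemma definable_term_minus:
  "definable_term L M F \<Longrightarrow> definable_term L M G \<Longrightarrow> definable_term L M (\<lambda>e. F e - G e)"
  using definable_term_app2[of L FAdd M F "\<lambda>e. Fun M FNeg [G e]"]
    definable_term_app1[of L FNeg M G] by simp

lemma definable_term_mult:
  "definable_term L M F \<Longrightarrow> definable_term L M G \<Longrightarrow> definable_term L M (\<lambda>e. F e * G e)"
  using definable_term_app2[of L FMul M F G] by simp

lemma definable_pred_le:
  "definable_term L M F \<Longrightarrow> definable_term L M G \<Longrightarrow> definable_pred L M (\<lambda>e. v (F e) \<le> v (G e))"
  using definable_pred_rel2[of L RDiv M F G] by simp

lemma definable_pred_less: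
  "definable_term L M F \<Longrightarrow> definable_term L M G \<Longrightarrow> definable_pred L M (\<lambda>e. v (F e) < v (G e))"
  using definable_pred_not[OF definable_pred_le[of G F]] by (simp add: not_le)

lemmas definable_intros = definable_term_var definable_term_const definable_term_minus
  definable_term_mult definable_pred_le definable_pred_less definable_pred_conj
  definable_pred_all_finite definable_pred_ex_finite

section \<open>C-minimality and definable cuts in the value group\<close>

lemma v_diff_eq_min:
  assumes "v x \<noteq> v y"
  shows "v (x - y) = min (v x) (v y)"
proof -
  have *: "v (x - y) = v x" if "v x < v y" for x y
  proof -
    have "v x \<le> v (x - y)" using v_add[of x "- y"] that by (simp add: min_absorb1)
    moreover have "min (v (x - y)) (v y) \<le> v x" using v_add[of "x - y" y] by simp
    ultimately show ?thesis using that by (auto simp: min_def split: if_splits)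
  qed
  show ?thesis
  proof (cases "v x < v y")
    case False
    with assms have "v y < v x" by simp
    with *[of y x] v_minus[of "x - y"] show ?thesis by simp
  qed (simp add: *)
qed

text \<open>If \<open>v x\<close> differs from \<open>v c\<close>, then \<open>v (x - c)\<close> is
  the minimum of the two, so membership of \<open>x\<close> in a ball about \<open>c\<close> depends
  only on the position of \<open>v x\<close> relative to the values of the centre and of the radius.
  \<open>E\<close> collects these finitely many elements.\<close>

lemma boolean_combination_locally_constant:
  assumes "B \<in> boolean_combinations (Univ M) (struct_balls M \<union> {{x} | x. x \<in> Univ M})"
  shows "\<exists>E. finite E \<and> (\<forall>x y. (\<forall>d\<in>E. v d < v x \<and> v d < v y \<or> v x < v d \<and> v y < v d) \<longrightarrow>
    (x \<in> B \<longleftrightarrow> y \<in> B))"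
  using assms
proof induction
  case (generator B)
  then consider c d where "B = {x. v d \<le> v (x - c)}" | c d where "B = {x. v d < v (x - c)}"
    | c where "B = {c}"
    unfolding struct_balls_def by (auto simp: vdiv_def not_le)
  then show ?case
  proof cases
    case (1 c d)
    have "x \<in> B \<longleftrightarrow> y \<in> B"
      if "\<forall>d\<in>{c, d}. v d < v x \<and> v d < v y \<or> v x < v d \<and> v y < v d" for x y
    proof -
      from that have "v (x - c) = min (v x) (v c)" "v (y - c) = min (v y) (v c)"
        by (auto intro!: v_diff_eq_min)
      with that show ?thesis by (auto simp: 1)
    qed
    then show ?thesis by (intro exI[of _ "{c, d}"]) blast
  next
    case (2 c d)
    have "x \<in> B \<longleftrightarrow> y \<in> B"
      if "\<forall>d\<in>{c, d}. v d < v x \<and> v d < v y \<or> v x < v d \<and> v y < v d" for x y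
    proof -
      from that have "v (x - c) = min (v x) (v c)" "v (y - c) = min (v y) (v c)"
        by (auto intro!: v_diff_eq_min)
      with that show ?thesis by (auto simp: 2)
    qed
    then show ?thesis by (intro exI[of _ "{c, d}"]) blast
  next
    \<comment> \<open>The condition at \<open>c\<close> itself rules out both \<open>x = c\<close>
      and \<open>y = c\<close>.\<close>
    case (3 c)
    then show ?thesis by (intro exI[of _ "{c}"]) auto
  qed
next
  case (complement B)
  then show ?case by auto
next
  case (union B C)
  then obtain E E' where "finite E" "finite E'"
    "\<forall>x y. (\<forall>d\<in>E. v d < v x \<and> v d < v y \<or> v x < v d \<and> v y < v d) \<longrightarrow> (x \<in> B \<longleftrightarrow> y \<in> B)"
    "\<forall>x y. (\<forall>d\<in>E'. v d < v x \<and> v d < v y \<or> v x < v d \<and> v y < v d) \<longrightarrow> (x \<in> C \<longleftrightarrow> y \<in> C)"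
    by blast
  then show ?case by (intro exI[of _ "E \<union> E'"]) (simp only: finite_Un ball_Un Un_iff, blast)
qed

text \<open>\<open>S\<close> describes a cut invariant under translation by \<open>v t\<close>. By
  C-minimality membership in \<open>S\<close> can change only at finitely many values; going one
  step \<open>t\<close> past the last of these on either side of the cut gives a member and a
  non-member that none of them separates.\<close>

lemma definable_downset_unbounded:
  assumes "definable_pred L M (\<lambda>e. e 0 \<in> S)"
    and down: "\<And>s s'. s \<in> S \<Longrightarrow> v s' \<le> v s \<Longrightarrow> s' \<in> S"
    and "t \<noteq> 0" "0 < v t"
    and step: "\<And>s. s \<in> S \<Longrightarrow> t * s \<in> S"
    and "s\<^sub>0 \<in> S" and "w \<noteq> 0"
  shows "w \<in> S"
proof (rule ccontr)
  assume w: "w \<notin> S"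
  have shift: "v s < v (t * s)" if "s \<noteq> 0" for s
  proof -
    have "v 1 < v t" using \<open>0 < v t\<close> by simp
    then have "v (s * 1) < v (s * t)" using v_mult_less_iff[OF that, of 1 t] by blast
    then show ?thesis by (simp add: mult.commute)
  qed
  have "definable L M 1 ((\<lambda>x. [x]) ` S)"
    using assms(1) by (rule definable_pred_imp_definable[OF Univ_M]) auto
  then have "S \<in> boolean_combinations (Univ M) (struct_balls M \<union> {{x} | x. x \<in> Univ M})"
    using c_min unfolding c_minimal_def by blast
  then obtain E where "finite E" and const:
    "\<And>x y. (\<forall>d\<in>E. v d < v x \<and> v d < v y \<or> v x < v d \<and> v y < v d) \<Longrightarrow> (x \<in> S \<longleftrightarrow> y \<in> S)"
    using boolean_combination_locally_constant by blast
  \<comment> \<open>The value of 0 is the largest, so \<open>down\<close> would otherwise put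
    \<open>w\<close> into \<open>S\<close>.\<close>
  have "0 \<notin> S" using down[of 0 w] w by auto
  \<comment> \<open>\<open>s\<close> and \<open>u\<close> will be the elements closest to the cut on
    its two sides; \<open>s\<^sub>0\<close> and \<open>w\<close> ensure that both sets are
    nonempty.\<close>
  let ?A = "insert s\<^sub>0 (E \<inter> S)" and ?B = "insert w (E - S)"
  have "Max (v ` ?A) \<in> v ` ?A" using \<open>finite E\<close> by (intro Max_in) auto
  then obtain s where s: "s \<in> ?A" "v s = Max (v ` ?A)" by (metis imageE)
  have s_max: "v d \<le> v s" if "d \<in> ?A" for d
    unfolding s(2) using \<open>finite E\<close> that by (intro Max_ge) auto
  have "Min (v ` ?B) \<in> v ` ?B" using \<open>finite E\<close> by (intro Min_in) auto
  then obtain u where u: "u \<in> ?B" "v u = Min (v ` ?B)" by (metis imageE)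
  have u_min: "v u \<le> v d" if "d \<in> ?B" for d
    unfolding u(2) using \<open>finite E\<close> that by (intro Min_le) auto
  have "s \<in> S" using s(1) \<open>s\<^sub>0 \<in> S\<close> by auto
  then have "s \<noteq> 0" using \<open>0 \<notin> S\<close> by auto
  have "u \<notin> S" using u(1) w by auto
  have "v u \<noteq> Pinf" using u_min[of w] \<open>w \<noteq> 0\<close> by auto
  then have "u / t \<noteq> 0" using \<open>t \<noteq> 0\<close> by simp
  have "t * s \<in> S" using step[OF \<open>s \<in> S\<close>] .
  \<comment> \<open>Multiplying by \<open>t\<close> would lead back to \<open>u\<close>, which is
    outside \<open>S\<close>.\<close>
  have "u / t \<notin> S" using step[of "u / t"] \<open>t \<noteq> 0\<close> \<open>u \<notin> S\<close> by auto
  have "v d < v (t * s) \<and> v d < v (u / t) \<or> v (t * s) < v d \<and> v (u / t) < v d" if "d \<in> E" for d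
  proof (cases "d \<in> S")
    case True
    have "v d < v (t * s)" using s_max[of d] shift[OF \<open>s \<noteq> 0\<close>] True that by auto
    moreover have "v d < v (u / t)" using down[OF True] \<open>u / t \<notin> S\<close> not_le by blast
    ultimately show ?thesis by simp
  next
    case False
    have "v (u / t) < v u" using shift[OF \<open>u / t \<noteq> 0\<close>] \<open>t \<noteq> 0\<close> by simp
    also have "\<dots> \<le> v d" using u_min[of d] False that by auto
    finally have "v (u / t) < v d" .
    moreover have "v (t * s) < v d" using down[OF \<open>t * s \<in> S\<close>] False not_le by blast
    ultimately show ?thesis by simp
  qed
  then show False using const \<open>t * s \<in> S\<close> \<open>u / t \<notin> S\<close> by blast
qed

section \<open>Roots from definable completeness\<close>

lemma definable_graph:
  fixes f :: "'a ^ 'n \<Rightarrow> 'a ^ 'm"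
  assumes "definable_vec_fun L M U f"
  shows "definable_pred L M (\<lambda>e. env_vec 0 e \<in> U \<and> env_vec CARD('n) e = f (env_vec 0 e))"
  using definable_imp_definable_pred[OF Univ_M assms[unfolded definable_vec_fun_def]]
  unfolding map_env_in_graph_iff .

lemma definable_vball:
  "definable_pred L M (\<lambda>e. env_vec m e \<in> vball (a :: 'a ^ 'n) d)"
  unfolding vball_def mem_Collect_eq less_vval_iff vector_minus_component env_vec_nth
  by (intro definable_intros)

text \<open>By \<open>expand\<close>, a root in the ball must lie in the closed ball about each
  \<open>x\<close> whose radius is the value of the residual scaled by \<open>c\<close>. Without a
  root all these radii are finite, and a common point of the balls would have a residual of value
  larger than its own.\<close>

lemma newton_root:
  fixes f :: "'a ^ 'n \<Rightarrow> 'a ^ 'n"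
  assumes f: "definable_vec_fun L M U f" and sub: "vball a d \<subseteq> U"
    and nonzero: "d \<noteq> 0" "c \<noteq> 0" "b \<noteq> 0" "t \<noteq> 0" and t: "0 < v t"
    and expand: "\<And>x x'. x \<in> vball a d \<Longrightarrow> x' \<in> vball a d \<Longrightarrow>
      vval v (c *s (f x - f x')) \<le> vval v (x - x')"
    and lipschitz: "\<And>x x'. x \<in> vball a d \<Longrightarrow> x' \<in> vball a d \<Longrightarrow>
      vval v (b *s (x - x')) \<le> vval v (f x - f x')"
    and start: "v d < vval v (c *s (y - f a))"
    and step: "\<And>x. x \<in> vball a d \<Longrightarrow> v d < vval v (c *s (y - f x)) \<Longrightarrow>
      \<exists>x'\<in>vball a d. vval v (t *s (c *s (y - f x))) \<le> vval v (c *s (y - f x'))"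
  shows "\<exists>x\<in>vball a d. f x = y"
proof (rule ccontr)
  assume no_root: "\<not> (\<exists>x\<in>vball a d. f x = y)"
  let ?n = "CARD('n)"
  define B where "B = vball a d"
  define r where "r x = vval v (c *s (y - f x))" for x
  have aB: "a \<in> B" using nonzero by (simp add: B_def)
  \<comment> \<open>The absence of a root enters here: it makes \<open>r x\<close> an admissible
    radius.\<close>
  have r_Fin: "\<exists>\<gamma>. r x = Fin \<gamma>" if "x \<in> B" for x
  proof -
    have "y - f x \<noteq> 0" using no_root that by (auto simp: B_def)
    then have "c *s (y - f x) \<noteq> 0" using nonzero by (simp add: vec.scale_eq_0_iff)
    then show ?thesis unfolding r_def by (rule vval_Fin)
  qed
  \<comment> \<open>This is what makes the balls a chain: the centre of the smaller one lies in the
    larger one.\<close>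
  have r_le: "min (r x) (r x') \<le> vval v (x - x')" if "x \<in> B" "x' \<in> B" for x x'
  proof -
    have "min (r x) (r x') \<le> vval v (c *s (y - f x') - c *s (y - f x))"
      unfolding r_def by (rule vval_diff) simp_all
    also have "c *s (y - f x') - c *s (y - f x) = c *s (f x - f x')"
      by (simp add: vec_eq_iff algebra_simps)
    also have "vval v \<dots> \<le> vval v (x - x')" using that expand by (simp add: B_def)
    finally show ?thesis .
  qed
  \<comment> \<open>The environment holds \<open>x\<close> at 0, \<open>f x\<close> at
    \<open>?n\<close> and \<open>s\<close> at \<open>?n + ?n\<close>; quantifying over the entries
    below \<open>?n + ?n\<close> leaves a condition on \<open>s\<close> alone.\<close>
  let ?P = "\<lambda>e. (env_vec 0 e \<in> U \<and> env_vec ?n e = f (env_vec 0 e)) \<and> env_vec 0 e \<in> B \<and>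
    (\<forall>i. v (e (?n + ?n)) \<le> v (c * (y $ i - env_vec ?n e $ i)))"
  have P_iff: "?P e \<longleftrightarrow> env_vec 0 e \<in> B \<and> env_vec ?n e = f (env_vec 0 e) \<and>
      v (e (?n + ?n)) \<le> r (env_vec 0 e)" for e
  proof (cases "env_vec ?n e = f (env_vec 0 e)")
    case True
    have "(\<forall>i. v (e (?n + ?n)) \<le> v (c * (y $ i - f (env_vec 0 e) $ i))) \<longleftrightarrow>
        v (e (?n + ?n)) \<le> r (env_vec 0 e)"
      by (simp only: r_def le_vval_iff vector_smult_component vector_minus_component)
    moreover have "env_vec 0 e \<in> B \<Longrightarrow> env_vec 0 e \<in> U" using sub by (auto simp: B_def)
    ultimately show ?thesis unfolding True by blast
  qed blast

  define S where "S = {s. \<exists>x\<in>B. v s \<le> r x}"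
  have "definable_pred L M ?P"
    unfolding env_vec_nth B_def by (intro definable_intros definable_graph[OF f] definable_vball)
  then have "definable_pred L M (\<lambda>e. \<exists>w. ?P (\<lambda>i. if i < ?n + ?n then w i else e i))"
    by (rule definable_pred_ex_many[OF Univ_M])
  moreover have "(\<exists>w. ?P (\<lambda>i. if i < ?n + ?n then w i else e i)) \<longleftrightarrow> e (?n + ?n) \<in> S" for e
  proof
    assume "e (?n + ?n) \<in> S"
    then obtain x where x: "x \<in> B" "v (e (?n + ?n)) \<le> r x" by (auto simp: S_def)
    define w where "w = (!) (coords x @ coords (f x) @ [e (?n + ?n)])"
    define e' where "e' = (\<lambda>i. if i < ?n + ?n then w i else e i)"
    have "env_vec 0 e' = (env_vec 0 w :: 'a ^ 'n)" "env_vec ?n e' = (env_vec ?n w :: 'a ^ 'n)"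
      unfolding e'_def by (rule env_vec_cong, simp)+
    then have low: "env_vec 0 e' = x" "env_vec ?n e' = f x" by (simp_all add: w_def)
    have "?P e'" unfolding P_iff unfolding low using x by (simp add: e'_def)
    then show "\<exists>w. ?P (\<lambda>i. if i < ?n + ?n then w i else e i)"
      unfolding e'_def by (rule exI[of _ w])
  next
    assume "\<exists>w. ?P (\<lambda>i. if i < ?n + ?n then w i else e i)"
    then obtain w where w: "?P (\<lambda>i. if i < ?n + ?n then w i else e i)" by (rule exE)
    define e' where "e' = (\<lambda>i. if i < ?n + ?n then w i else e i)"
    have "?P e'" using w unfolding e'_def .
    then have "env_vec 0 e' \<in> B" "v (e' (?n + ?n)) \<le> r (env_vec 0 e')"
      unfolding P_iff by auto
    then show "e (?n + ?n) \<in> S" unfolding S_def by (auto simp: e'_def)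
  qed
  ultimately have "definable_pred L M (\<lambda>e. e (?n + ?n) \<in> S)" by simp
  \<comment> \<open>The remaining variable is moved from index \<open>?n + ?n\<close> to index
    0.\<close>
  from definable_pred_subst[OF this, of "\<lambda>_. 0"] have S: "definable_pred L M (\<lambda>e. e 0 \<in> S)" by simp

  have S_step: "t * s \<in> S" if "s \<in> S" for s
  proof -
    from that obtain x where x: "x \<in> B" "v s \<le> r x" by (auto simp: S_def)
    \<comment> \<open>\<open>step\<close> requires a residual of value above \<open>v d\<close>. If
      \<open>x\<close> fails this, the centre \<open>a\<close> has a residual of larger value by
      \<open>start\<close> and replaces it.\<close>
    define x' where "x' = (if v d < r x then x else a)"
    have x': "x' \<in> B" "v d < r x'" "v s \<le> r x'"
      using x aB start unfolding x'_def r_def by auto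
    then obtain x'' where x'': "x'' \<in> B" "vval v (t *s (c *s (y - f x'))) \<le> r x''"
      using step[of x'] unfolding B_def r_def by blast
    have "v s \<le> v (c * (y $ i - f x' $ i))" for i
      using x'(3) unfolding r_def le_vval_iff vector_smult_component vector_minus_component ..
    then have "v (t * s) \<le> v (t * (c * (y $ i - f x' $ i)))" for i by (rule v_mult_mono)
    then have "v (t * s) \<le> vval v (t *s (c *s (y - f x')))"
      by (simp only: le_vval_iff vector_smult_component vector_minus_component simp_thms)
    then show ?thesis using x'' unfolding S_def by (blast intro: order.trans)
  qed
  have "d \<in> S" using aB start unfolding S_def r_def by (blast intro: less_imp_le)
  then have unbounded: "\<exists>x\<in>B. v s \<le> r x" if "s \<noteq> 0" for s
    using definable_downset_unbounded[OF S _ \<open>t \<noteq> 0\<close> t S_step _ that]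
    unfolding S_def by (blast intro: order.trans)

  have "\<exists>w. \<forall>x\<in>B. r x \<le> v (w - x $ i)" for i
  proof -
    \<comment> \<open>Definable completeness concerns balls of the home sort, hence one coordinate
      at a time. The index is the pair of \<open>x\<close> and \<open>f x\<close>, so that the
      residual is given by terms in the index.\<close>
    let ?I = "(\<lambda>x. coords x @ coords (f x)) ` B"
    let ?Q = "\<lambda>e. \<exists>j. v (c * (y $ j - env_vec ?n e $ j)) \<le> v (e (?n + ?n) - env_vec 0 e $ i)"
    have Q_iff: "?Q e \<longleftrightarrow> vval v (c *s (y - env_vec ?n e)) \<le> v (e (?n + ?n) - env_vec 0 e $ i)" for e
      by (simp only: vval_le_iff vector_smult_component vector_minus_component)
    define S where "S = {xs. length xs = ?n + ?n + 1 \<and> ?Q ((!) xs)}"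
    have fibre_eq: "fibre S (coords x @ coords (f x)) = {w. r x \<le> v (w - x $ i)}" for x
      unfolding fibre_def S_def mem_Collect_eq Q_iff r_def by simp
    have vball: "is_vball_of_radius v (fibre S (coords x @ coords (f x))) \<gamma>" if "r x = Fin \<gamma>" for x \<gamma>
      unfolding is_vball_of_radius_def closed_vball_def fibre_eq that by blast
    have "definable L M (?n + ?n) ?I"
    proof (rule definable_pred_imp_definable[OF Univ_M])
      show "definable_pred L M (\<lambda>e. (env_vec 0 e \<in> U \<and> env_vec ?n e = f (env_vec 0 e)) \<and> env_vec 0 e \<in> B)"
        unfolding B_def by (intro definable_intros definable_graph[OF f] definable_vball)
      show "map e [0..<?n + ?n] \<in> ?I \<longleftrightarrow>
          (env_vec 0 e \<in> U \<and> env_vec ?n e = f (env_vec 0 e)) \<and> env_vec 0 e \<in> B" for e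
        unfolding map_env_in_graph_iff using sub by (auto simp: B_def)
    qed auto
    moreover have "definable L M (?n + ?n + 1) S"
    proof (rule definable_pred_imp_definable[OF Univ_M])
      show "definable_pred L M ?Q"
        unfolding env_vec_nth by (intro definable_intros)
      have "env_vec 0 ((!) (map e [0..<?n + ?n + 1])) = (env_vec 0 e :: 'a ^ 'n)"
        "env_vec ?n ((!) (map e [0..<?n + ?n + 1])) = (env_vec ?n e :: 'a ^ 'n)"
        "map e [0..<?n + ?n + 1] ! (?n + ?n) = e (?n + ?n)" for e :: "nat \<Rightarrow> 'a"
        by (rule env_vec_cong, simp del: upt_Suc)+ (simp del: upt_Suc)
      then show "map e [0..<?n + ?n + 1] \<in> S \<longleftrightarrow> ?Q e" for e
        unfolding S_def mem_Collect_eq Q_iff by (simp del: upt_Suc)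
    qed (simp add: S_def)
    moreover have "\<forall>p\<in>?I. \<exists>\<gamma>. is_vball_of_radius v (fibre S p) \<gamma>"
      using vball r_Fin by blast
    moreover have "\<forall>p\<in>?I. \<forall>q\<in>?I. fibre S p \<subseteq> fibre S q \<or> fibre S q \<subseteq> fibre S p"
    proof -
      have "{w. r x' \<le> v (w - x' $ i)} \<subseteq> {w. r x \<le> v (w - x $ i)}"
        if "x \<in> B" "x' \<in> B" "r x \<le> r x'" for x x'
      proof safe
        fix w assume "r x' \<le> v (w - x' $ i)"
        moreover have "r x \<le> v (x' $ i - x $ i)"
          using r_le[OF that(2,1)] that(3) by (simp add: le_vval_iff min_absorb2)
        ultimately have "r x \<le> min (v (w - x' $ i)) (v (x' $ i - x $ i))"
          using that(3) by (simp add: order.trans)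
        also have "\<dots> \<le> v (w - x $ i)" using v_add[of "w - x' $ i" "x' $ i - x $ i"] by simp
        finally show "r x \<le> v (w - x $ i)" .
      qed
      then have "fibre S (coords x @ coords (f x)) \<subseteq> fibre S (coords x' @ coords (f x')) \<or>
          fibre S (coords x' @ coords (f x')) \<subseteq> fibre S (coords x @ coords (f x))"
        if "x \<in> B" "x' \<in> B" for x x'
        unfolding fibre_eq using that linear[of "r x" "r x'"] by metis
      then show ?thesis by blast
    qed
    moreover have "\<forall>\<gamma>. \<exists>p\<in>?I. \<exists>\<delta>\<ge>\<gamma>. is_vball_of_radius v (fibre S p) \<delta>"
    proof
      fix \<gamma>
      obtain s where s: "s \<noteq> 0" "v s = Fin \<gamma>" using v_surj by blast
      then obtain x where x: "x \<in> B" "Fin \<gamma> \<le> r x" using unbounded by metis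
      moreover obtain \<delta> where "r x = Fin \<delta>" using r_Fin[OF x(1)] by blast
      ultimately show "\<exists>p\<in>?I. \<exists>\<delta>\<ge>\<gamma>. is_vball_of_radius v (fibre S p) \<delta>"
        using vball by auto
    qed
    ultimately have "(\<Inter>p\<in>?I. fibre S p) \<noteq> {}"
      using complete[unfolded definably_complete_def, rule_format, of "?n + ?n" ?I S] by blast
    then obtain w where "\<And>x. x \<in> B \<Longrightarrow> w \<in> fibre S (coords x @ coords (f x))" by blast
    then show ?thesis unfolding fibre_eq by blast
  qed
  then obtain \<zeta> where \<zeta>: "\<And>i x. x \<in> B \<Longrightarrow> r x \<le> v (\<zeta> i - x $ i)" by metis
  define z where "z = (\<chi> i. \<zeta> i)"
  have z: "r x \<le> vval v (z - x)" if "x \<in> B" for x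
    using \<zeta>[OF that] by (simp add: z_def le_vval_iff)
  have shift: "v s < v (t * s)" if "s \<noteq> 0" for s
    using v_mult_less_iff[OF that, of 1 t] t by (simp add: mult.commute)
  have "z \<in> B"
  proof -
    \<comment> \<open>A radius of value above \<open>v d\<close> keeps \<open>z\<close> close enough
      to a point of the ball to be in the ball itself.\<close>
    obtain x where x: "x \<in> B" "v (t * d) \<le> r x" using unbounded[of "t * d"] nonzero by auto
    have "v d < v (t * d)" using shift nonzero by simp
    also have "\<dots> \<le> vval v (z - x)" using x z by (blast intro: order.trans)
    finally have "v d < vval v ((z - x) + (x - a))"
      using x(1) by (intro vval_add_less) (simp_all add: B_def vball_def)
    then show ?thesis by (simp add: B_def vball_def)
  qed
  obtain \<rho> where "r z = Fin \<rho>" using r_Fin[OF \<open>z \<in> B\<close>] by blast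
  moreover obtain s where "s \<noteq> 0" "v s = Fin \<rho>" using v_surj by blast
  ultimately have s: "s \<noteq> 0" "r z = v s" by simp_all
  \<comment> \<open>The first bound makes the residual at \<open>x\<close> better than that at
    \<open>z\<close> by \<open>v t\<close>. The second brings \<open>x\<close> so close to
    \<open>z\<close> that, after the losses \<open>b\<close> from \<open>lipschitz\<close> and
    \<open>c\<close> from scaling, the images differ by at least the value
    \<open>v (t * s)\<close>.\<close>
  obtain x where x: "x \<in> B" "v (t * s) \<le> r x" "v (t * s / (c * b)) \<le> r x"
  proof -
    obtain s' where "s' \<noteq> 0" "v (t * s) \<le> v s'" "v (t * s / (c * b)) \<le> v s'"
      using linear[of "v (t * s)" "v (t * s / (c * b))"] s(1) nonzero
      by (metis divide_eq_0_iff mult_eq_0_iff order_refl)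
    with unbounded that show thesis by (meson order.trans)
  qed
  have "v (t * s) \<le> vval v (c *s (f z - f x))"
  proof -
    have "v (t * s / (c * b)) \<le> vval v (z - x)" using x z by (blast intro: order.trans)
    then have "v (c * b * (t * s / (c * b))) \<le> v (c * b * (z - x) $ i)" for i
      unfolding le_vval_iff by (blast intro: v_mult_mono)
    then have "v (c * b * (t * s / (c * b))) \<le> vval v (c *s (b *s (z - x)))"
      unfolding le_vval_iff by (simp only: vector_smult_component mult.assoc simp_thms)
    also have "\<dots> \<le> vval v (c *s (f z - f x))"
      using lipschitz \<open>z \<in> B\<close> x(1) by (intro vval_scale_mono) (simp add: B_def)
    finally show ?thesis using nonzero by simp
  qed
  \<comment> \<open>The residual at \<open>z\<close> is the residual at \<open>x\<close> minus the
    scaled difference of images, and both have value at least \<open>v (t * s)\<close>, which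
    exceeds \<open>r z\<close>.\<close>
  with x(2) have "v (t * s) \<le> vval v (c *s (y - f x) - c *s (f z - f x))"
    unfolding r_def by (rule vval_diff)
  also have "c *s (y - f x) - c *s (f z - f x) = c *s (y - f z)"
    by (simp add: vec_eq_iff algebra_simps)
  finally have "v (t * s) \<le> v s" using s(2) by (simp only: r_def)
  with shift[OF s(1)] show False by simp
qed

section \<open>The inverse function theorem\<close>

text \<open>The bound \<open>expand\<close> forces the derivative \<open>h\<close> at
  \<open>g y\<^sub>0\<close> to be injective, and a linear left inverse of \<open>h\<close> is the
  strict derivative of \<open>g\<close>.\<close>

lemma inverse_strictly_differentiable:
  fixes f g :: "'a ^ 'n \<Rightarrow> 'a ^ 'n"
  assumes U: "openin (vec_topology v) U" and f: "has_strict_derivative v U f h (g y\<^sub>0)"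
    and B: "g y\<^sub>0 \<in> B" "openin (vec_topology v) B" and "c \<noteq> 0"
    and expand: "\<And>x x'. x \<in> B \<Longrightarrow> x' \<in> B \<Longrightarrow> vval v (c *s (f x - f x')) \<le> vval v (x - x')"
    and V: "openin (vec_topology v) V" "y\<^sub>0 \<in> V"
    and g: "\<And>y. y \<in> V \<Longrightarrow> g y \<in> B" "\<And>y. y \<in> V \<Longrightarrow> f (g y) = y"
  shows "\<exists>h'. has_strict_derivative v V g h' y\<^sub>0"
proof -
  let ?p = "g y\<^sub>0"
  have "?p \<in> U" using f by (simp add: has_strict_derivative_def)
  note f_iff = has_strict_derivative_iff[OF U this]
  have h: "Vector_Spaces.linear (*s) (*s) h" using f unfolding f_iff by (rule conjunct1)
  have strict: "\<exists>d. d \<noteq> 0 \<and> vball ?p d \<subseteq> U \<and> (\<forall>x\<in>vball ?p d. \<forall>x'\<in>vball ?p d. x \<noteq> x' \<longrightarrow>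
      vval v (k *s (x - x')) < vval v (f x - f x' - h (x - x')))" if "k \<noteq> 0" for k
    by (rule f[unfolded f_iff, THEN conjunct2, THEN spec, THEN mp, OF that])
  obtain d\<^sub>B where d\<^sub>B: "d\<^sub>B \<noteq> 0" "vball ?p d\<^sub>B \<subseteq> B"
    using openin_vec_topology[THEN iffD1, THEN bspec, OF B(2,1)] by (elim exE conjE)
  have "h w \<noteq> 0" if "w \<noteq> 0" for w
  proof
    assume "h w = 0"
    \<comment> \<open>Along a kernel vector \<open>f\<close> varies only by the error term. At scale
      \<open>1 / c\<close> the error is so small that it contradicts \<open>expand\<close>.\<close>
    have "1 / c \<noteq> 0" using \<open>c \<noteq> 0\<close> by simp
    from strict[OF this] obtain d where d: "d \<noteq> 0"
      and small: "\<forall>x\<in>vball ?p d. \<forall>x'\<in>vball ?p d. x \<noteq> x' \<longrightarrow>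
        vval v ((1 / c) *s (x - x')) < vval v (f x - f x' - h (x - x'))"
      by (elim exE conjE)
    obtain d' where d': "d' \<noteq> 0" "v d \<le> v d'" "v d\<^sub>B \<le> v d'"
      using ex_upper_value[OF d d\<^sub>B(1)] by blast
    obtain t where t: "t \<noteq> 0" "0 < v t" using ex_positive_value by blast
    obtain i where i: "vval v w = v (w $ i)" "\<And>c. vval v (c *s w) = v (c * w $ i)"
      using vval_scale_attained by blast
    have "w $ i \<noteq> 0" using i(1) \<open>w \<noteq> 0\<close> by (metis v_zero vval_eq_Pinf)
    \<comment> \<open>The coordinate \<open>i\<close> attains the minimum, so the value of
      \<open>s *s w\<close> is exactly \<open>v (d' * t)\<close>, just beyond the radius
      \<open>d'\<close>.\<close>
    define s where "s = d' * t / w $ i"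
    have "s \<noteq> 0" using \<open>w $ i \<noteq> 0\<close> t d' by (simp add: s_def)
    have "v (d' * 1) < v (d' * t)" using v_mult_less_iff[OF d'(1), of 1 t] t by simp
    also have "v (d' * t) = vval v (s *s w)" using \<open>w $ i \<noteq> 0\<close> by (simp add: i(2) s_def)
    finally have s: "v d' < vval v (s *s w)" by simp
    define x where "x = ?p + s *s w"
    have x: "x - ?p = s *s w" by (simp add: x_def)
    have "x \<in> vball ?p d'" unfolding vball_def mem_Collect_eq x by (rule s)
    then have "x \<in> vball ?p d" "x \<in> B" using vball_mono d' d\<^sub>B(2) by blast+
    moreover have "x \<noteq> ?p" using \<open>s \<noteq> 0\<close> \<open>w \<noteq> 0\<close> by (simp add: x_def vec.scale_eq_0_iff)
    moreover have "h (x - ?p) = 0"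
      unfolding x using vec.linear_scale[OF h] \<open>h w = 0\<close> by simp
    ultimately have "vval v ((1 / c) *s (x - ?p)) < vval v (f x - f ?p)"
      using small[rule_format, of x ?p] d by simp
    then have "vval v (c *s ((1 / c) *s (x - ?p))) < vval v (c *s (f x - f ?p))"
      by (rule vval_scale_less_iff[OF \<open>c \<noteq> 0\<close>, THEN iffD2])
    also have "\<dots> \<le> vval v (x - ?p)" using expand \<open>x \<in> B\<close> B(1) by blast
    finally show False using \<open>c \<noteq> 0\<close> by (simp only: vector_smult_assoc) simp
  qed
  then have nonzero: "h w = 0 \<Longrightarrow> w = 0" for w by blast
  have "inj h"
  proof (rule injI)
    fix x y assume "h x = h y"
    then have "h (x - y) = 0" by (simp add: vec.linear_diff[OF h])
    then show "x = y" using nonzero[of "x - y"] by simp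
  qed
  from vec.linear_injective_left_inverse[OF h this]
  obtain h' where h': "Vector_Spaces.linear (*s) (*s) h'" and "h' \<circ> h = id" by (elim exE conjE)
  then have left_inv: "h' (h x) = x" for x by (metis comp_apply id_apply)
  obtain b where b: "b \<noteq> 0" "\<And>x. vval v (b *s x) \<le> vval v (h' x)"
    using linear_lower_bound[OF h'] by blast
  obtain d\<^sub>V where d\<^sub>V: "d\<^sub>V \<noteq> 0" "vball y\<^sub>0 d\<^sub>V \<subseteq> V"
    using openin_vec_topology[THEN iffD1, THEN bspec, OF V] by (elim exE conjE)
  have "\<exists>d. d \<noteq> 0 \<and> vball y\<^sub>0 d \<subseteq> V \<and> (\<forall>y\<in>vball y\<^sub>0 d. \<forall>y'\<in>vball y\<^sub>0 d. y \<noteq> y' \<longrightarrow>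
      vval v (k *s (y - y')) < vval v (g y - g y' - h' (y - y')))" if "k \<noteq> 0" for k
  proof -
    \<comment> \<open>The factor \<open>b\<close> pays for applying \<open>h'\<close>, and
      \<open>c\<close> for passing from differences of arguments of \<open>g\<close> to differences
      of its values.\<close>
    have "k / (b * c) \<noteq> 0" using \<open>c \<noteq> 0\<close> b(1) that by simp
    from strict[OF this] obtain d where d: "d \<noteq> 0"
      and small: "\<forall>x\<in>vball ?p d. \<forall>x'\<in>vball ?p d. x \<noteq> x' \<longrightarrow>
        vval v ((k / (b * c)) *s (x - x')) < vval v (f x - f x' - h (x - x'))"
      by (elim exE conjE)
    \<comment> \<open>By \<open>expand\<close>, \<open>g\<close> maps points of \<open>V\<close>
      within radius \<open>d / c\<close> of \<open>y\<^sub>0\<close> into the ball of radius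
      \<open>d\<close> about \<open>?p\<close>.\<close>
    have "d / c \<noteq> 0" using d \<open>c \<noteq> 0\<close> by simp
    then obtain d' where d': "d' \<noteq> 0" "v (d / c) \<le> v d'" "v d\<^sub>V \<le> v d'"
      using ex_upper_value[OF _ d\<^sub>V(1)] by blast
    have sub: "vball y\<^sub>0 d' \<subseteq> V" using vball_mono[OF d'(3)] d\<^sub>V(2) by blast
    have near: "g y \<in> vball ?p d" if y: "y \<in> vball y\<^sub>0 d'" for y
    proof -
      have "v (d / c) < vval v (y - y\<^sub>0)" using y d'(2) by (simp add: vball_def)
      then have "v d < vval v (c *s (y - y\<^sub>0))"
        by (rule scaled_less_iff[OF \<open>c \<noteq> 0\<close>, THEN iffD2])
      also have "\<dots> \<le> vval v (g y - ?p)"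
        using expand[of "g y" ?p] g[of y] g[of y\<^sub>0] V(2) sub y by auto
      finally show ?thesis by (simp add: vball_def)
    qed
    have "vval v (k *s (y - y')) < vval v (g y - g y' - h' (y - y'))"
      if y: "y \<in> vball y\<^sub>0 d'" "y' \<in> vball y\<^sub>0 d'" "y \<noteq> y'" for y y'
    proof -
      let ?e = "y - y' - h (g y - g y')"
      have fg: "f (g y) = y" "f (g y') = y'" "g y \<in> B" "g y' \<in> B" using g sub y by auto
      have "k *s (y - y') = (k / c) *s (c *s (y - y'))"
        using \<open>c \<noteq> 0\<close> by (simp only: vector_smult_assoc) simp
      also have "vval v \<dots> \<le> vval v ((k / c) *s (g y - g y'))"
        using expand[OF fg(3,4)] unfolding fg(1,2) by (rule vval_scale_mono)
      also have "(k / c) *s (g y - g y') = b *s ((k / (b * c)) *s (g y - g y'))"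
        using b(1) by (simp only: vector_smult_assoc) simp
      also have "vval v \<dots> < vval v (b *s ?e)"
      proof (rule vval_scale_less_iff[OF b(1), THEN iffD2])
        have "g y \<noteq> g y'" using fg(1,2) y(3) by auto
        from small[rule_format, OF near[OF y(1)] near[OF y(2)] this]
        show "vval v ((k / (b * c)) *s (g y - g y')) < vval v ?e" unfolding fg(1,2) .
      qed
      also have "\<dots> \<le> vval v (h' ?e)" by (rule b(2))
      \<comment> \<open>Up to sign, the left inverse turns the error of \<open>f\<close> into the
        error of \<open>g\<close>.\<close>
      also have "h' ?e = h' (y - y') - (g y - g y')"
        by (simp only: vec.linear_diff[OF h'] left_inv)
      also have "vval v \<dots> = vval v (g y - g y' - h' (y - y'))" by (rule vval_minus_commute)
      finally show ?thesis .
    qed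
    with d'(1) sub show ?thesis by (intro exI[of _ d'] conjI ballI impI)
  qed
  with h' show ?thesis
    by (intro exI[of _ h'] has_strict_derivative_iff[OF V, THEN iffD2] conjI allI impI)
qed

theorem inverse_function:
  fixes f Df :: "'a ^ 'n \<Rightarrow> 'a ^ 'n"
  assumes U: "openin (vec_topology v) U" and f: "definable_vec_fun L M U f"
    and diff: "strictly_differentiable_on v U f"
    and a: "a \<in> U" "has_strict_derivative v U f Df a" "invertible (matrix Df)"
  shows "\<exists>U\<^sub>0 V\<^sub>0 g.
    openin (vec_topology v) U\<^sub>0 \<and> a \<in> U\<^sub>0 \<and> U\<^sub>0 \<subseteq> U \<and>
    openin (vec_topology v) V\<^sub>0 \<and> f a \<in> V\<^sub>0 \<and>
    homeomorphic_maps (subtopology (vec_topology v) U\<^sub>0) (subtopology (vec_topology v) V\<^sub>0) f g \<and>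
    strictly_differentiable_on v V\<^sub>0 g"
proof -
  note f_iff = has_strict_derivative_iff[OF U a(1)]
  have Df: "Vector_Spaces.linear (*s) (*s) Df" using a(2) unfolding f_iff by (rule conjunct1)
  obtain A' where A': "matrix Df ** A' = mat 1" "A' ** matrix Df = mat 1"
    using a(3) unfolding invertible_def by blast
  define A where "A w = A' *v w" for w
  have A: "Vector_Spaces.linear (*s) (*s) A" unfolding A_def by (rule matrix_vector_mul_linear_gen)
  have Df_A: "Df (A w) = w" and A_Df: "A (Df w) = w" for w
    by (simp_all add: A_def A' matrix_vector_mul_assoc flip: matrix_works[OF Df])
  obtain c where c: "c \<noteq> 0" "\<And>w. vval v (c *s w) \<le> vval v (A w)"
    using linear_lower_bound[OF A] by blast
  obtain c' where c': "c' \<noteq> 0" "\<And>w. vval v (c' *s w) \<le> vval v (Df w)"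
    using linear_lower_bound[OF Df] by blast
  obtain t where t: "t \<noteq> 0" "0 < v t" using ex_positive_value by blast
  have t_mono: "vval v w \<le> vval v (t *s w)" for w :: "'a ^ 'n"
    using vval_scale_mono_left[of 1 t w] t(2) by simp
  have tc: "c *s ((t / c) *s w) = t *s w" for w :: "'a ^ 'n"
    using c(1) by (simp only: vector_smult_assoc) simp
  \<comment> \<open>Applying \<open>A\<close> costs at most \<open>v c\<close>; at scale
    \<open>t / c\<close> the linearization error still gains \<open>v t\<close> over
    \<open>x - x'\<close> afterwards.\<close>
  have "t / c \<noteq> 0" using c t by simp
  from a(2)[unfolded f_iff, THEN conjunct2, THEN spec, THEN mp, OF this]
  obtain d where d: "d \<noteq> 0" "vball a d \<subseteq> U"
    and strict: "\<forall>x\<in>vball a d. \<forall>x'\<in>vball a d. x \<noteq> x' \<longrightarrow>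
      vval v ((t / c) *s (x - x')) < vval v (f x - f x' - Df (x - x'))"
    by (elim exE conjE)
  define B where "B = vball a d"
  have B: "openin (vec_topology v) B" "a \<in> B" "B \<subseteq> U"
    using d openin_vball by (auto simp: B_def)

  have expand: "vval v (c *s (f x - f x')) \<le> vval v (x - x')" if x: "x \<in> B" "x' \<in> B" for x x'
  proof (cases "x = x'")
    case False
    \<comment> \<open>If \<open>expand\<close> failed, both \<open>A (f x - f x')\<close> and
      \<open>A ?e\<close> would have values above that of \<open>x - x'\<close>, which is their
      difference.\<close>
    let ?e = "f x - f x' - Df (x - x')"
    show ?thesis
    proof (rule ccontr)
      assume "\<not> ?thesis"
      then have "vval v (x - x') < vval v (c *s (f x - f x'))" by simp
      also have "\<dots> \<le> vval v (A (f x - f x'))" by (rule c(2))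
      finally have less1: "vval v (x - x') < vval v (A (f x - f x'))" .
      have "vval v (x - x') \<le> vval v (t *s (x - x'))" by (rule t_mono)
      also have "\<dots> = vval v (c *s ((t / c) *s (x - x')))" by (simp only: tc)
      also have "\<dots> < vval v (c *s ?e)"
        using strict[rule_format, OF x[unfolded B_def] False] by (rule vval_scale_less_iff[OF c(1), THEN iffD2])
      also have "\<dots> \<le> vval v (A ?e)" by (rule c(2))
      finally have "vval v (x - x') < vval v (A ?e)" .
      with less1 have "vval v (x - x') < vval v (A (f x - f x') - A ?e)" by (rule vval_diff_less)
      also have "A (f x - f x') - A ?e = x - x'"
        by (simp only: vec.linear_diff[OF A, of "f x - f x'" "Df (x - x')"] A_Df) simp
      finally show False by simp
    qed
  qed simp
  \<comment> \<open>\<open>b\<close> bounds both parts of \<open>f x - f x'\<close>: through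
    \<open>c'\<close> the linear part and through \<open>t / c\<close> the error.\<close>
  obtain b where b: "b \<noteq> 0" "v b \<le> v c'" "v b \<le> v (t / c)"
    using ex_lower_value[OF c'(1) \<open>t / c \<noteq> 0\<close>] by blast
  have lipschitz: "vval v (b *s (x - x')) \<le> vval v (f x - f x')" if x: "x \<in> B" "x' \<in> B" for x x'
  proof (cases "x = x'")
    case False
    have "vval v (b *s (x - x')) \<le> vval v (c' *s (x - x'))"
      using b(2) by (rule vval_scale_mono_left)
    then have le1: "vval v (b *s (x - x')) \<le> vval v (Df (x - x'))" using c'(2) by (rule order.trans)
    have "vval v (b *s (x - x')) \<le> vval v ((t / c) *s (x - x'))"
      using b(3) by (rule vval_scale_mono_left)
    then have "vval v (b *s (x - x')) \<le> vval v (f x - f x' - Df (x - x'))"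
      using strict[rule_format, OF x[unfolded B_def] False] by (rule order.trans[OF _ less_imp_le])
    from vval_add[OF this le1] show ?thesis by simp
  qed simp
  have step: "\<exists>x'\<in>B. vval v (t *s (c *s (y - f x))) \<le> vval v (c *s (y - f x'))"
    if x: "x \<in> B" "v d < vval v (c *s (y - f x))" for x y
  proof (cases "y = f x")
    case False
    define w where "w = A (y - f x)"
    have w: "vval v (c *s (y - f x)) \<le> vval v w" unfolding w_def by (rule c(2))
    \<comment> \<open>This is the Newton step; since \<open>Df w = y - f x\<close>, the new residual
      is, up to sign, the linearization error between \<open>x'\<close> and
      \<open>x\<close>.\<close>
    define x' where "x' = x + w"
    have "v d < vval v (w + (x - a))"
      using x w by (intro vval_add_less) (simp_all add: B_def vball_def less_le_trans)
    then have x': "x' \<in> B" by (simp add: x'_def B_def vball_def algebra_simps)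
    have "Df w = y - f x" by (simp add: w_def Df_A)
    then have "w \<noteq> 0" using False vec.linear_scale[OF Df, of 0 w] by auto
    then have "x' \<noteq> x" by (simp add: x'_def)
    have "vval v (t *s (c *s (y - f x))) \<le> vval v (t *s w)" using w by (rule vval_scale_mono)
    also have "\<dots> = vval v (c *s ((t / c) *s w))" by (simp only: tc)
    also have "\<dots> \<le> vval v (c *s (f x' - f x - Df w))"
      using strict[rule_format, of x' x] x(1) x' \<open>x' \<noteq> x\<close>
      by (intro vval_scale_mono) (simp add: B_def x'_def less_imp_le)
    also have "f x' - f x - Df w = f x' - y" using \<open>Df w = y - f x\<close> by simp
    also have "vval v (c *s (f x' - y)) = vval v (c *s (y - f x'))"
      by (simp only: vval_scale vval_minus_commute[of "f x'"])
    finally show ?thesis using x' by blast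
  \<comment> \<open>At a root the point \<open>x\<close> itself serves, as both residuals
    vanish.\<close>
  qed (use x in \<open>auto intro!: bexI[of _ x]\<close>)

  \<comment> \<open>The radius \<open>d / c\<close> is the one that gives the condition
    \<open>start\<close> of \<open>newton_root\<close> for every \<open>y\<close> in
    \<open>V\<close>.\<close>
  define V where "V = vball (f a) (d / c)"
  have V: "openin (vec_topology v) V" "f a \<in> V"
    using openin_vball d(1) c(1) by (simp_all add: V_def)
  have "\<exists>x\<in>B. f x = y" if "y \<in> V" for y
  proof -
    have "v (d / c) < vval v (y - f a)" using that by (simp add: V_def vball_def)
    then have "v d < vval v (c *s (y - f a))" by (rule scaled_less_iff[OF c(1), THEN iffD2])
    then show ?thesis unfolding B_def
      by (intro newton_root[OF f d(2,1) c(1) b(1) t]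
          expand[unfolded B_def] lipschitz[unfolded B_def] step[unfolded B_def])
  qed
  then obtain g where g: "\<And>y. y \<in> V \<Longrightarrow> g y \<in> B" "\<And>y. y \<in> V \<Longrightarrow> f (g y) = y" by metis
  \<comment> \<open>\<open>expand\<close> makes \<open>f\<close> injective on \<open>B\<close>:
    equal images force the difference to have value \<open>Pinf\<close>.\<close>
  have gf: "g (f x) = x" if "x \<in> B" "f x \<in> V" for x
  proof -
    have "vval v (c *s (f (g (f x)) - f x)) \<le> vval v (g (f x) - x)"
      using g that by (intro expand) auto
    then have "vval v (g (f x) - x) = Pinf" using g(2)[OF that(2)] by simp
    then show ?thesis by simp
  qed
  \<comment> \<open>\<open>f\<close> may send points of \<open>B\<close> outside \<open>V\<close>,
    so the neighbourhood of \<open>a\<close> is cut down to the preimage of \<open>V\<close>, which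
    is open by continuity.\<close>
  define W where "W = {x \<in> B. f x \<in> V}"
  have "continuous_map (subtopology (vec_topology v) B) (subtopology (vec_topology v) UNIV) f"
    using b(1) lipschitz by (rule continuous_map_of_lower_bound) auto
  then have "openin (subtopology (vec_topology v) B) W"
    using openin_continuous_map_preimage[of _ "vec_topology v" f V] V(1) by (fastforce simp: W_def)
  then have W: "openin (vec_topology v) W" "a \<in> W" "W \<subseteq> U"
    using B V by (auto simp: openin_open_subtopology W_def)
  have "homeomorphic_maps (subtopology (vec_topology v) W) (subtopology (vec_topology v) V) f g"
    unfolding homeomorphic_maps_def
  proof (intro conjI ballI)
    show "continuous_map (subtopology (vec_topology v) W) (subtopology (vec_topology v) V) f"
      using b(1)
    proof (rule continuous_map_of_lower_bound)
      show "vval v (b *s (x - x')) \<le> vval v (f x - f x')" if "x \<in> W" "x' \<in> W" for x x'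
        using that by (intro lipschitz) (simp_all add: W_def)
      show "f ` W \<subseteq> V" by (auto simp: W_def)
    qed
    show "continuous_map (subtopology (vec_topology v) V) (subtopology (vec_topology v) W) g"
      using c(1)
    proof (rule continuous_map_of_lower_bound)
      show "vval v (c *s (y - y')) \<le> vval v (g y - g y')" if "y \<in> V" "y' \<in> V" for y y'
        using expand[OF g(1) g(1), OF that] unfolding g(2)[OF that(1)] g(2)[OF that(2)] .
      show "g ` V \<subseteq> W" using g by (auto simp: W_def)
    qed
  qed (auto simp: W_def gf g)
  moreover have "strictly_differentiable_on v V g"
    unfolding strictly_differentiable_on_def
  proof
    fix y assume "y \<in> V"
    with g B(3) have "g y \<in> U" by blast
    with diff obtain h where "has_strict_derivative v U f h (g y)"
      unfolding strictly_differentiable_on_def by blast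
    then show "\<exists>h'. has_strict_derivative v V g h' y"
      using \<open>y \<in> V\<close> g B(1) c(1) V(1) expand
      by (intro inverse_strictly_differentiable[OF U, where B = B and c = c and f = f]) auto
  qed
  ultimately show ?thesis using W V by blast
qed

end

theorem theorem9p7:
  fixes L :: "('f, 'r) lang"
    and T :: "('f, 'r) fm set"
    and \<kappa> :: "'k rel"
    and M :: "('a::field, 'f, 'r) struct"
    and v :: "'a \<Rightarrow> 'g::linordered_ab_group_add extended"
    and t :: 'f
    and U :: "('a ^ 'n) set"
    and f Df :: "'a ^ 'n \<Rightarrow> 'a ^ 'n"
    and a :: "'a ^ 'n"
  assumes "complete_c_minimal_acvf_expansion TYPE('a) L T"
    and "monster_model L \<kappa> T M"
    and "interprets_valued_field M v"
    and "ext_farity L t = 0" and "0 < v (Fun M (FExt t) [])"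
    and "definably_complete L M v"
    and "definable_vec_set L M U" and "openin (vec_topology v) U"
    and "definable_vec_fun L M U f" and "strictly_differentiable_on v U f"
    and "a \<in> U" and "has_strict_derivative v U f Df a" and "invertible (matrix Df)"
  shows "\<exists>U\<^sub>0 V\<^sub>0 g.
    openin (vec_topology v) U\<^sub>0 \<and> a \<in> U\<^sub>0 \<and> U\<^sub>0 \<subseteq> U \<and>
    openin (vec_topology v) V\<^sub>0 \<and> f a \<in> V\<^sub>0 \<and>
    homeomorphic_maps (subtopology (vec_topology v) U\<^sub>0) (subtopology (vec_topology v) V\<^sub>0) f g \<and>
    strictly_differentiable_on v V\<^sub>0 g"
proof -
  \<comment> \<open>\<open>M\<close> is itself one of the models over which
    \<open>complete_c_minimal_acvf_expansion\<close> quantifies.\<close>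
  have "is_model L M T" using assms(2) by (simp add: monster_model_def)
  then have "acvf M" "c_minimal L M"
    using assms(1) by (auto simp: complete_c_minimal_acvf_expansion_def)
  then interpret definably_complete_field L M v
    using assms by unfold_locales
  show ?thesis using assms by (intro inverse_function)
qed

end
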